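(* Let $(A,\mathbf{B})$ be a real bipartite rank $6$ table algebra with $\mathbf{N}=\ker\phi=\{b_0,b_2,b_3\}$. Let $\delta_i=\delta(b_i)$ and $n=\sum_{i=0}^5\delta_i$. Then $(A,\mathbf{B})$ is integral if and only if $$\delta_1=1,\quad \delta_2=\delta_3=\delta_4,\quad 2\mid\delta_2,\quad\text{and}\quad 8\mid(n-2).$$ Furthermore, if $(A,\mathbf{B})$ is integral, then $\mathbf{B}$ is exactly isomorphic to $\operatorname{Aut}(\mathbf{N})\ltimes\mathbf{N}$.
   Context: A reality-based algebra (RBA) $(A,\mathbf{B})$ of rank $r$ is a finite-dimensional $\mathbb{C}$-algebra $A$ with conjugate-semilinear involution $*$ ($(\alpha x)^*=\bar\alpha x^*$, $(xy)^*=y^*x^*$) and a distinguished basis $\mathbf{B}=\{b_0,\dots,b_{r-1}\}$ such that: (1) $b_0=1_A$; (2) the structure constants $\lambda_{ijk}$ in $b_ib_j=\sum_k\lambda_{ijk}b_k$ are real; (3) $\mathbf{B}^*=\mathbf{B}$, and one writes $b_{i^*}=(b_i)^*$; (4) $\lambda_{ij0}\ne0$ if and only if $j=i^*$; (5) $\lambda_{ii^*0}=\lambda_{i^*i0}>0$. A positive degree map is a one-dimensional algebra homomorphism $\delta:A\to\mathbb{C}$ with $\delta(a^* )=\overline{\delta(a)}$ and $\delta(b_i)>0$ for all $i$. The basis is standard if $\delta(b_i)=\lambda_{ii^*0}$ for all $i$. A table algebra is an RBA whose structure constants are all nonnegative; it is integral if all structure constants with respect to its standard basis are integers. A noncommutative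 rank $6$ table algebra with positive degree map $\delta$ and standard basis $\mathbf{B}$ has irreducible characters $\delta$, a second linear character $\phi$, and $\chi$ of degree $2$; the basis is labelled so that $b_i^*=b_i$ for $i=1,2,3$ and $b_4^*=b_5$. Write $n=\sum_i\delta(b_i)$; the standard feasible trace $\tau(\sum_i\alpha_ib_i)=n\alpha_0$ equals $\delta+m_\phi\phi+m_\chi\chi$, where $m_\phi,m_\chi>0$ are the multiplicities. The kernel is $\ker\phi=\{b_i\in\mathbf{B}:\phi(b_i)=\delta(b_i)\}$. A real bipartite rank $6$ table algebra is a noncommutative rank $6$ table algebra (with standard basis) with $m_\phi=1$ such that $\ker\phi$ has exactly three elements, all $*$-invariant, labelled $\ker\phi=\{b_0,b_2,b_3\}$. The kernel is a closed subset of $\mathbf{B}$, i.e. its linear span is a table algebra with basis $\mathbf{N}$. An exact isomorphism between standard table bases is a bijection whose linear extension is an algebra isomorphism. $\operatorname{Aut}(\mathbf{N})$ is the group of exact isomorphisms $\mathbf{N}\to\mathbf{N}$. For a table algebra $(A',\mathbf{B}')$ and a subgroup $G\le\operatorname{Aut}(\mathbf{B}')$, the semidirect product $G\ltimes\mathbf{B}'$ is the table basis with underlying set $G\times\mathbf{B}'$ and multiplication $(g,b)\cdot(h,c)=(gh,b^hc)$ for $g,h\in G$, $b,c\in\mathbf{B}'$, where $b^h=h(b)$ (extended linearly). *)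

theory Defs
  imports "HOL-Analysis.Analysis" "HOL-Library.Poly_Mapping" "HOL-Combinatorics.Permutations"
begin

section \<open>Reality-based algebras and table algebras\<close>

locale complex_star_algebra = vector_space cscale
  for cscale :: "complex \<Rightarrow> 'a::ring_1 \<Rightarrow> 'a" +
  fixes star :: "'a \<Rightarrow> 'a"
  assumes scale_mult_left: "cscale c x * y = cscale c (x * y)"
    and scale_mult_right: "x * cscale c y = cscale c (x * y)"
    and star_add: "star (x + y) = star x + star y"
    and star_scale: "star (cscale c x) = cscale (cnj c) (star x)"
    and star_mult: "star (x * y) = star y * star x"
    and star_star: "star (star x) = x"

text \<open>The basis is the family \<open>b 0, \<dots>, b (r - 1)\<close>; values \<open>b i\<close> with \<open>i \<ge> r\<close> are irrelevant.\<close>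

definition struct_const ::
  "(complex \<Rightarrow> 'a::ring_1 \<Rightarrow> 'a) \<Rightarrow> nat \<Rightarrow> (nat \<Rightarrow> 'a) \<Rightarrow> nat \<Rightarrow> nat \<Rightarrow> nat \<Rightarrow> complex"
  where "struct_const cscale r b i j k =
    module.representation cscale (b ` {..<r}) (b i * b j) (b k)"

definition star_index :: "('a \<Rightarrow> 'a) \<Rightarrow> nat \<Rightarrow> (nat \<Rightarrow> 'a) \<Rightarrow> nat \<Rightarrow> nat"
  where "star_index star r b i = (THE j. j < r \<and> b j = star (b i))"

locale reality_based_algebra = complex_star_algebra cscale star
  for cscale :: "complex \<Rightarrow> 'a::ring_1 \<Rightarrow> 'a" and star :: "'a \<Rightarrow> 'a" +
  fixes r :: nat and b :: "nat \<Rightarrow> 'a"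
  assumes inj_basis: "inj_on b {..<r}"
    and independent_basis: "independent (b ` {..<r})"
    and span_basis: "span (b ` {..<r}) = UNIV"
    and basis_0: "b 0 = 1"
    and struct_const_real:
      "\<lbrakk>i < r; j < r; k < r\<rbrakk> \<Longrightarrow> struct_const cscale r b i j k \<in> \<real>"
    and star_basis: "star ` (b ` {..<r}) = b ` {..<r}"
    and struct_const_0_iff:
      "\<lbrakk>i < r; j < r\<rbrakk> \<Longrightarrow> struct_const cscale r b i j 0 \<noteq> 0 \<longleftrightarrow> j = star_index star r b i"
    and struct_const_star_eq:
      "i < r \<Longrightarrow> struct_const cscale r b i (star_index star r b i) 0
         = struct_const cscale r b (star_index star r b i) i 0"
    and struct_const_star_pos:
      "i < r \<Longrightarrow> 0 < Re (struct_const cscale r b i (star_index star r b i) 0)"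

definition linear_character ::
  "(complex \<Rightarrow> 'a::ring_1 \<Rightarrow> 'a) \<Rightarrow> ('a \<Rightarrow> complex) \<Rightarrow> bool"
  where "linear_character cscale f \<longleftrightarrow>
    Vector_Spaces.linear cscale (*) f \<and> f 1 = 1 \<and> (\<forall>x y. f (x * y) = f x * f y)"

definition positive_degree_map ::
  "(complex \<Rightarrow> 'a::ring_1 \<Rightarrow> 'a) \<Rightarrow> ('a \<Rightarrow> 'a) \<Rightarrow> nat \<Rightarrow> (nat \<Rightarrow> 'a) \<Rightarrow> ('a \<Rightarrow> complex) \<Rightarrow> bool"
  where "positive_degree_map cscale star r b \<delta> \<longleftrightarrow>
    linear_character cscale \<delta> \<and> (\<forall>x. \<delta> (star x) = cnj (\<delta> x)) \<and>
    (\<forall>i<r. \<delta> (b i) \<in> \<real> \<and> 0 < Re (\<delta> (b i)))"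

locale table_algebra = reality_based_algebra cscale star r b
  for cscale :: "complex \<Rightarrow> 'a::ring_1 \<Rightarrow> 'a" and star r b +
  assumes struct_const_nonneg:
    "\<lbrakk>i < r; j < r; k < r\<rbrakk> \<Longrightarrow> 0 \<le> Re (struct_const cscale r b i j k)"

locale standard_table_algebra = table_algebra cscale star r b
  for cscale :: "complex \<Rightarrow> 'a::ring_1 \<Rightarrow> 'a" and star r b +
  fixes \<delta> :: "'a \<Rightarrow> complex"
  assumes degree_map: "positive_degree_map cscale star r b \<delta>"
    and standard: "i < r \<Longrightarrow> \<delta> (b i) = struct_const cscale r b i (star_index star r b i) 0"

text \<open>To be applied to the standard basis.\<close>

definition integral_basis ::
  "(complex \<Rightarrow> 'a::ring_1 \<Rightarrow> 'a) \<Rightarrow> nat \<Rightarrow> (nat \<Rightarrow> 'a) \<Rightarrow> bool"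
  where "integral_basis cscale r b \<longleftrightarrow>
    (\<forall>i<r. \<forall>j<r. \<forall>k<r. struct_const cscale r b i j k \<in> \<int>)"

section \<open>Noncommutative table algebras of rank 6\<close>

definition irreducible_representation ::
  "(complex \<Rightarrow> 'a::ring_1 \<Rightarrow> 'a) \<Rightarrow> ('a \<Rightarrow> complex^'n^'n) \<Rightarrow> bool"
  where "irreducible_representation cscale \<rho> \<longleftrightarrow>
    (\<forall>x y. \<rho> (x + y) = \<rho> x + \<rho> y) \<and>
    (\<forall>c x. \<rho> (cscale c x) = (\<chi> i j. c * \<rho> x $ i $ j)) \<and>
    \<rho> 1 = mat 1 \<and>
    (\<forall>x y. \<rho> (x * y) = \<rho> x ** \<rho> y) \<and>
    (\<forall>W. vec.subspace W \<and> (\<forall>x. \<forall>w\<in>W. \<rho> x *v w \<in> W) \<longrightarrow> W = {0} \<or> W = UNIV)"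

definition irreducible_character_2 ::
  "(complex \<Rightarrow> 'a::ring_1 \<Rightarrow> 'a) \<Rightarrow> ('a \<Rightarrow> complex) \<Rightarrow> bool"
  where "irreducible_character_2 cscale f \<longleftrightarrow>
    (\<exists>\<rho> :: 'a \<Rightarrow> complex^2^2. irreducible_representation cscale \<rho> \<and> f = (\<lambda>x. trace (\<rho> x)))"

definition standard_feasible_trace ::
  "(complex \<Rightarrow> 'a::ring_1 \<Rightarrow> 'a) \<Rightarrow> nat \<Rightarrow> (nat \<Rightarrow> 'a) \<Rightarrow> ('a \<Rightarrow> complex) \<Rightarrow> 'a \<Rightarrow> complex"
  where "standard_feasible_trace cscale r b \<delta> x =
    (\<Sum>i<r. \<delta> (b i)) * module.representation cscale (b ` {..<r}) x (b 0)"

locale noncommutative_rank6_table_algebra = standard_table_algebra cscale star 6 b \<delta>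
  for cscale :: "complex \<Rightarrow> 'a::ring_1 \<Rightarrow> 'a" and star b \<delta> +
  fixes \<phi> X :: "'a \<Rightarrow> complex" and m\<^sub>\<phi> m\<^sub>X :: real
  assumes noncommutative: "\<exists>x y :: 'a. x * y \<noteq> y * x"
    and phi: "linear_character cscale \<phi>" "\<phi> \<noteq> \<delta>"
    and X: "irreducible_character_2 cscale X"
    and multiplicities_pos: "0 < m\<^sub>\<phi>" "0 < m\<^sub>X"
    and multiplicities: "standard_feasible_trace cscale 6 b \<delta> x
      = \<delta> x + of_real m\<^sub>\<phi> * \<phi> x + of_real m\<^sub>X * X x"
    and star_123: "star (b 1) = b 1" "star (b 2) = b 2" "star (b 3) = b 3"
    and star_45: "star (b 4) = b 5"

definition character_kernel ::
  "nat \<Rightarrow> (nat \<Rightarrow> 'a) \<Rightarrow> ('a \<Rightarrow> complex) \<Rightarrow> ('a \<Rightarrow> complex) \<Rightarrow> 'a set"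
  where "character_kernel r b \<delta> f = {x \<in> b ` {..<r}. f x = \<delta> x}"

locale real_bipartite_rank6_table_algebra =
  noncommutative_rank6_table_algebra cscale star b \<delta> \<phi> X m\<^sub>\<phi> m\<^sub>X
  for cscale :: "complex \<Rightarrow> 'a::ring_1 \<Rightarrow> 'a" and star b \<delta> \<phi> X m\<^sub>\<phi> m\<^sub>X +
  assumes multiplicity_phi: "m\<^sub>\<phi> = 1"
    and kernel_phi: "character_kernel 6 b \<delta> \<phi> = {b 0, b 2, b 3}"

section \<open>Exact isomorphisms and semidirect products\<close>

text \<open>
  A record value describes the algebra whose underlying space is the span of \<open>basis\<close> (which may
  be a proper subspace of the type), with multiplication \<open>mul\<close> restricted to that span.
\<close>

record 'a based_algebra =
  smul :: "complex \<Rightarrow> 'a \<Rightarrow> 'a"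
  mul :: "'a \<Rightarrow> 'a \<Rightarrow> 'a"
  unit :: 'a
  basis :: "'a set"

definition based_on :: "(complex \<Rightarrow> 'a::ring_1 \<Rightarrow> 'a) \<Rightarrow> 'a set \<Rightarrow> 'a based_algebra"
  where "based_on cscale S = \<lparr>smul = cscale, mul = (*), unit = 1, basis = S\<rparr>"

definition carrier_of :: "'a::ab_group_add based_algebra \<Rightarrow> 'a set"
  where "carrier_of A = module.span (smul A) (basis A)"

definition coord :: "'a::ab_group_add based_algebra \<Rightarrow> 'a \<Rightarrow> 'a \<Rightarrow> complex"
  where "coord A x d = module.representation (smul A) (basis A) x d"

definition lin_ext ::
  "'a::ab_group_add based_algebra \<Rightarrow> 'b::ab_group_add based_algebra \<Rightarrow> ('a \<Rightarrow> 'b) \<Rightarrow> 'a \<Rightarrow> 'b"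
  where "lin_ext A A' f x = (\<Sum>d\<in>basis A. smul A' (coord A x d) (f d))"

definition algebra_iso ::
  "'a::ab_group_add based_algebra \<Rightarrow> 'b::ab_group_add based_algebra \<Rightarrow> ('a \<Rightarrow> 'b) \<Rightarrow> bool"
  where "algebra_iso A A' F \<longleftrightarrow>
    bij_betw F (carrier_of A) (carrier_of A') \<and>
    (\<forall>x\<in>carrier_of A. \<forall>y\<in>carrier_of A. F (x + y) = F x + F y) \<and>
    (\<forall>c. \<forall>x\<in>carrier_of A. F (smul A c x) = smul A' c (F x)) \<and>
    (\<forall>x\<in>carrier_of A. \<forall>y\<in>carrier_of A. F (mul A x y) = mul A' (F x) (F y)) \<and>
    F (unit A) = unit A'"

definition exact_iso ::
  "'a::ab_group_add based_algebra \<Rightarrow> 'b::ab_group_add based_algebra \<Rightarrow> ('a \<Rightarrow> 'b) \<Rightarrow> bool"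
  where "exact_iso A A' f \<longleftrightarrow>
    bij_betw f (basis A) (basis A') \<and> algebra_iso A A' (lin_ext A A' f)"

definition exactly_isomorphic ::
  "'a::ab_group_add based_algebra \<Rightarrow> 'b::ab_group_add based_algebra \<Rightarrow> bool"
  where "exactly_isomorphic A A' \<longleftrightarrow> (\<exists>f. exact_iso A A' f)"

text \<open>
  Bijections of the basis are represented by functions that fix everything outside it, so that
  each one has exactly one representative and the group operation is function composition.
\<close>

definition exact_aut :: "'a::ab_group_add based_algebra \<Rightarrow> ('a \<Rightarrow> 'a) set"
  where "exact_aut A = {g. g permutes basis A \<and> exact_iso A A g}"

text \<open>
  The algebra of \<open>G \<ltimes> B\<close> is the vector space with basis \<open>G \<times> B\<close>, realised as finitely supported
  functions, with \<open>(g, d)\<close> standing for \<open>single (g, d) 1\<close>; \<open>sd_embed A k x\<close> is \<open>(k, x)\<close>,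
  extended linearly in \<open>x\<close>.  Automorphisms act from the right, \<open>d\<^sup>h = h d\<close>, so the product \<open>gh\<close> in
  \<open>(g, d) (h, e) = (gh, d\<^sup>h e)\<close> is "first \<open>g\<close>, then \<open>h\<close>", that is \<open>h \<circ> g\<close>.
\<close>

definition sd_embed ::
  "'a::ab_group_add based_algebra \<Rightarrow> ('a \<Rightarrow> 'a) \<Rightarrow> 'a \<Rightarrow> (('a \<Rightarrow> 'a) \<times> 'a \<Rightarrow>\<^sub>0 complex)"
  where "sd_embed A k x = (\<Sum>d\<in>basis A. Poly_Mapping.single (k, d) (coord A x d))"

definition sd_smul :: "complex \<Rightarrow> ('p \<Rightarrow>\<^sub>0 complex) \<Rightarrow> ('p \<Rightarrow>\<^sub>0 complex)"
  where "sd_smul c u = Poly_Mapping.map ((*) c) u"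

definition sd_mul ::
  "('a \<Rightarrow> 'a) set \<Rightarrow> 'a::ab_group_add based_algebra \<Rightarrow>
    (('a \<Rightarrow> 'a) \<times> 'a \<Rightarrow>\<^sub>0 complex) \<Rightarrow> (('a \<Rightarrow> 'a) \<times> 'a \<Rightarrow>\<^sub>0 complex) \<Rightarrow>
    (('a \<Rightarrow> 'a) \<times> 'a \<Rightarrow>\<^sub>0 complex)"
  where "sd_mul G A u v =
    (\<Sum>(g, d)\<in>G \<times> basis A. \<Sum>(h, e)\<in>G \<times> basis A.
      sd_smul (Poly_Mapping.lookup u (g, d) * Poly_Mapping.lookup v (h, e))
        (sd_embed A (h \<circ> g) (mul A (h d) e)))"

definition semidirect ::
  "('a \<Rightarrow> 'a) set \<Rightarrow> 'a::ab_group_add based_algebra \<Rightarrow>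
    (('a \<Rightarrow> 'a) \<times> 'a \<Rightarrow>\<^sub>0 complex) based_algebra"
  where "semidirect G A =
    \<lparr>smul = sd_smul, mul = sd_mul G A, unit = Poly_Mapping.single (id, unit A) 1,
     basis = (\<lambda>p. Poly_Mapping.single p 1) ` (G \<times> basis A)\<rparr>"

end

theory Submission
  imports Defs
begin

text \<open>
  Write \<open>t x\<close> for the coefficient of \<open>x\<close> at \<open>b 0\<close>; it is a nondegenerate trace form, and the trace
  formula \<open>n t = \<delta> + \<phi> + m\<^sub>X X\<close> shows that \<open>\<delta>\<close>, \<open>\<phi>\<close> and the representation \<open>\<rho>\<close> affording \<open>X\<close> are
  jointly faithful. As \<open>\<phi>\<close> has multiplicity 1, orthogonality forces \<open>\<phi> (b i) = \<plusminus> \<delta> (b i)\<close>, which is a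
  grading of the algebra with even part spanned by the kernel. An element killed by \<open>\<phi> - \<delta>\<close> and by
  \<open>\<rho>\<close> is a multiple of \<open>b 0 + b 2 + b 3\<close>. By the Cayley-Hamilton theorem this applies to
  \<open>b i * b i - X (b i) b i + det (\<rho> (b i))\<close>, so that the coefficients of these squares at \<open>b 2\<close> and
  \<open>b 3\<close> differ only by the known value \<open>X (b i)\<close>. For \<open>i = 2\<close> integrality of the difference gives
  \<open>\<delta> (b 2) = \<delta> (b 3) = m\<close>; for \<open>i = 1\<close> and \<open>i = 4\<close>, with \<open>\<delta>\<^sub>i = \<delta> (b i)\<close>, comparing degrees gives
  \<open>2 * m dvd \<delta>\<^sub>1 * (\<delta>\<^sub>1 - 1)\<close> and \<open>2 * m dvd \<delta>\<^sub>4 * \<delta>\<^sub>4\<close>, which together with \<open>\<delta>\<^sub>1 + 2 * \<delta>\<^sub>4 = 1 + 2 * m\<close>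
  leave only \<open>\<delta>\<^sub>1 = 1\<close>, \<open>\<delta>\<^sub>4 = m\<close> with \<open>m\<close> even. Conversely, these degrees make \<open>b 1\<close> an involution
  conjugating \<open>b 2\<close> to \<open>b 3\<close>, and this determines the whole multiplication table.
\<close>

section \<open>Coordinates and the trace form\<close>

context reality_based_algebra
begin

definition coeff :: "'a \<Rightarrow> nat \<Rightarrow> complex"
  where "coeff x i = representation (b ` {..<r}) x (b i)"

lemma struct_const_eq_coeff: "struct_const cscale r b i j k = coeff (b i * b j) k"
  by (simp add: struct_const_def coeff_def)

lemma coeff_add: "coeff (x + y) i = coeff x i + coeff y i"
  by (simp add: coeff_def representation_add independent_basis span_basis)

lemma coeff_scale: "coeff (cscale c x) i = c * coeff x i"
  by (simp add: coeff_def representation_scale independent_basis span_basis)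

lemma coeff_zero: "coeff 0 i = 0"
  by (simp add: coeff_def representation_zero)

lemma coeff_sum: "coeff (sum f I) i = (\<Sum>j\<in>I. coeff (f j) i)"
  by (simp add: coeff_def representation_sum independent_basis span_basis)

lemma basis_eq_iff: "i < r \<Longrightarrow> j < r \<Longrightarrow> b i = b j \<longleftrightarrow> i = j"
  using inj_basis by (auto simp: inj_on_def)

lemma coeff_basis: "i < r \<Longrightarrow> j < r \<Longrightarrow> coeff (b i) j = (if j = i then 1 else 0)"
  by (simp add: coeff_def representation_basis independent_basis basis_eq_iff)

lemma coeff_expansion: "(\<Sum>i<r. cscale (coeff x i) (b i)) = x"
proof -
  have "(\<Sum>i<r. cscale (coeff x i) (b i)) =
      (\<Sum>d\<in>b ` {..<r}. cscale (representation (b ` {..<r}) x d) d)"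
    by (simp add: sum.reindex[OF inj_basis] coeff_def)
  also have "\<dots> = x"
    by (rule sum_representation_eq[OF independent_basis]) (auto simp: span_basis)
  finally show ?thesis .
qed

lemma coeff_eqI:
  assumes "\<And>i. i < r \<Longrightarrow> coeff x i = coeff y i"
  shows "x = y"
proof -
  have "(\<Sum>i<r. cscale (coeff x i) (b i)) = (\<Sum>i<r. cscale (coeff y i) (b i))"
    using assms by (intro sum.cong) auto
  then show ?thesis by (simp only: coeff_expansion)
qed

lemma linear_functional_eq_sum:
  assumes "Vector_Spaces.linear cscale (*) f"
  shows "f x = (\<Sum>i<r. coeff x i * f (b i))"
proof -
  interpret f: Vector_Spaces.linear cscale "(*)" f by (rule assms)
  have "f x = f (\<Sum>i<r. cscale (coeff x i) (b i))" by (simp only: coeff_expansion)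
  then show ?thesis by (simp only: f.sum f.scale)
qed

lemma star_index_exists:
  assumes "i < r" shows "\<exists>!j. j < r \<and> b j = star (b i)"
proof -
  have "star (b i) \<in> b ` {..<r}" using star_basis assms by blast
  then show ?thesis by (auto simp: basis_eq_iff)
qed

abbreviation si :: "nat \<Rightarrow> nat" where "si \<equiv> star_index star r b"

lemma star_index:
  assumes "i < r" shows "si i < r" "b (si i) = star (b i)"
  using theI'[OF star_index_exists[OF assms]] by (simp_all add: star_index_def)

lemma star_index_eqI: "i < r \<Longrightarrow> j < r \<Longrightarrow> b j = star (b i) \<Longrightarrow> si i = j"
  using star_index by (simp flip: basis_eq_iff)

lemma star_index_star_index: "i < r \<Longrightarrow> si (si i) = i"
  by (intro star_index_eqI) (simp_all add: star_index star_star)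

text \<open>The case \<open>j = si i\<close> is \<open>struct_const_star_eq\<close>; otherwise both
  sides vanish, because \<open>si\<close> is an involution.\<close>

lemma trace_form_comm_basis:
  assumes "i < r" "j < r"
  shows "coeff (b i * b j) 0 = coeff (b j * b i) 0"
proof (cases "j = si i")
  case True
  then show ?thesis
    using struct_const_star_eq[OF assms(1)] by (simp add: struct_const_eq_coeff)
next
  case False
  then have "i \<noteq> si j" using assms by (auto simp: star_index_star_index)
  then show ?thesis
    using False struct_const_0_iff[OF assms] struct_const_0_iff[OF assms(2,1)]
    by (simp add: struct_const_eq_coeff)
qed

lemma mult_expansion:
  "x * y = (\<Sum>i<r. \<Sum>j<r. cscale (coeff x i * coeff y j) (b i * b j))"
proof -
  have "x * y = (\<Sum>i<r. cscale (coeff x i) (b i)) * (\<Sum>j<r. cscale (coeff y j) (b j))"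
    by (simp only: coeff_expansion)
  also have "\<dots> = (\<Sum>i<r. \<Sum>j<r. cscale (coeff x i * coeff y j) (b i * b j))"
    by (simp add: sum_product scale_mult_left scale_mult_right mult.commute)
  finally show ?thesis .
qed

lemma trace_form_comm: "coeff (x * y) 0 = coeff (y * x) 0"
proof -
  have "coeff (x * y) 0 = (\<Sum>i<r. \<Sum>j<r. (coeff x i * coeff y j) * coeff (b i * b j) 0)"
    by (subst mult_expansion) (simp add: coeff_sum coeff_scale)
  also have "\<dots> = (\<Sum>i<r. \<Sum>j<r. (coeff y j * coeff x i) * coeff (b j * b i) 0)"
    by (intro sum.cong refl) (simp add: trace_form_comm_basis mult.commute)
  also have "\<dots> = (\<Sum>j<r. \<Sum>i<r. (coeff y j * coeff x i) * coeff (b j * b i) 0)"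
    by (rule sum.swap)
  also have "\<dots> = coeff (y * x) 0"
    by (subst mult_expansion) (simp add: coeff_sum coeff_scale)
  finally show ?thesis .
qed

end

section \<open>Degrees, and the elements representing characters in the trace form\<close>

context standard_table_algebra
begin

definition deg :: "nat \<Rightarrow> real" where "deg i = Re (\<delta> (b i))"

lemma linear_degree: "Vector_Spaces.linear cscale (*) \<delta>"
  using degree_map by (simp add: positive_degree_map_def linear_character_def)

lemma degree_mult: "\<delta> (x * y) = \<delta> x * \<delta> y" and degree_one: "\<delta> 1 = 1"
  and degree_star: "\<delta> (star x) = cnj (\<delta> x)"
  using degree_map by (simp_all add: positive_degree_map_def linear_character_def)

lemma degree_basis: "i < r \<Longrightarrow> \<delta> (b i) = of_real (deg i)"
  using degree_map by (simp add: positive_degree_map_def deg_def)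

lemma deg_pos: "i < r \<Longrightarrow> 0 < deg i"
  using degree_map by (simp add: positive_degree_map_def deg_def)

lemma deg_star_index: "i < r \<Longrightarrow> deg (si i) = deg i"
  by (simp add: deg_def star_index degree_star)

lemma coeff_0_mult_basis:
  assumes "i < r" "j < r"
  shows "coeff (b i * b j) 0 = (if j = si i then of_real (deg i) else 0)"
  using struct_const_0_iff[OF assms] standard[OF assms(1)] degree_basis[OF assms(1)]
  by (auto simp: struct_const_eq_coeff)

text \<open>Against \<open>b (si k)\<close> the trace form sees only \<open>b k\<close>. So the
  elements \<open>b (si k)\<close> divided by \<open>deg k\<close> form the dual basis, and
  coordinates can be recovered from traces.\<close>

lemma coeff_0_mult_star:
  assumes "k < r"
  shows "coeff (x * b (si k)) 0 = of_real (deg k) * coeff x k"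
proof -
  have eq: "si k = si i \<longleftrightarrow> i = k" if "i < r" for i
    using that assms by (metis star_index_star_index)
  have "coeff (x * b (si k)) 0 = (\<Sum>i<r. coeff x i * coeff (b i * b (si k)) 0)"
    by (subst coeff_expansion[of x, symmetric])
       (simp only: sum_distrib_right scale_mult_left coeff_sum coeff_scale)
  also have "\<dots> = (\<Sum>i<r. if i = k then coeff x k * of_real (deg k) else 0)"
    using assms by (intro sum.cong) (auto simp: coeff_0_mult_basis star_index(1) eq)
  also have "\<dots> = of_real (deg k) * coeff x k"
    using assms by simp
  finally show ?thesis .
qed

lemma trace_form_nondegenerate:
  assumes "\<And>k. k < r \<Longrightarrow> coeff (x * b k) 0 = coeff (y * b k) 0"
  shows "x = y"
proof (rule coeff_eqI)
  fix i assume i: "i < r"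
  have "of_real (deg i) * coeff x i = of_real (deg i) * coeff y i"
    using assms[of "si i"] i by (simp add: coeff_0_mult_star star_index(1))
  then show "coeff x i = coeff y i" using deg_pos[OF i] by simp
qed

text \<open>A linear character is replaced by its values on the basis, so that the conjugated values
  can be treated in the same way although conjugating a character does not give a linear map. The
  zero family also qualifies, hence the condition on \<open>p 0\<close> in later lemmas.\<close>

definition multiplicative :: "(nat \<Rightarrow> complex) \<Rightarrow> bool"
  where "multiplicative p \<longleftrightarrow>
    (\<forall>i<r. \<forall>j<r. (\<Sum>k<r. coeff (b i * b j) k * p k) = p i * p j)"

lemma multiplicative_linear_character:
  assumes "linear_character cscale f"
  shows "multiplicative (\<lambda>i. f (b i))"
proof -
  have "(\<Sum>k<r. coeff x k * f (b k)) = f x" for x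
    using assms by (metis linear_functional_eq_sum linear_character_def)
  then show ?thesis using assms by (simp add: multiplicative_def linear_character_def)
qed

text \<open>A multiple of the central idempotent of the character with values \<open>p\<close>.\<close>

definition char_elem :: "(nat \<Rightarrow> complex) \<Rightarrow> 'a"
  where "char_elem p = (\<Sum>i<r. cscale (p (si i) / of_real (deg i)) (b i))"

lemma coeff_char_elem:
  assumes "i < r" shows "coeff (char_elem p) i = p (si i) / of_real (deg i)"
proof -
  have "coeff (char_elem p) i =
      (\<Sum>j<r. p (si j) / of_real (deg j) * (if i = j then 1 else 0))"
    using assms unfolding char_elem_def coeff_sum coeff_scale
    by (intro sum.cong) (auto simp: coeff_basis)
  then show ?thesis using assms by (simp add: sum.delta' if_distrib cong: if_cong)
qed

text \<open>The weights in \<open>char_elem\<close> are those of the dual basis, so pairing with it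
  in the trace form gives the functional with values \<open>p\<close>.\<close>

lemma coeff_0_char_elem_mult:
  assumes "k < r" shows "coeff (char_elem p * b k) 0 = p k"
  using coeff_0_mult_star[of "si k" "char_elem p"] assms deg_pos[of k]
  by (simp add: star_index(1) star_index_star_index coeff_char_elem deg_star_index)

text \<open>Tested against \<open>b k\<close> in the trace form: cyclicity brings \<open>b j\<close>
  to the right of \<open>b k\<close>, where multiplicativity splits off \<open>p j\<close>.\<close>

lemma mult_char_elem:
  assumes p: "multiplicative p" and j: "j < r"
  shows "b j * char_elem p = cscale (p j) (char_elem p)"
proof (rule trace_form_nondegenerate)
  fix k assume k: "k < r"
  have "coeff (b j * char_elem p * b k) 0 = coeff (char_elem p * (b k * b j)) 0"
    by (metis trace_form_comm mult.assoc)
  also have "\<dots> = (\<Sum>i<r. coeff (b k * b j) i * coeff (char_elem p * b i) 0)"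
    by (subst coeff_expansion[of "b k * b j", symmetric])
       (simp only: sum_distrib_left scale_mult_right coeff_sum coeff_scale)
  also have "\<dots> = (\<Sum>i<r. coeff (b k * b j) i * p i)"
    by (simp add: coeff_0_char_elem_mult)
  also have "\<dots> = p k * p j" using p j k by (simp add: multiplicative_def)
  also have "\<dots> = coeff (cscale (p j) (char_elem p) * b k) 0"
    using k by (simp add: scale_mult_left coeff_scale coeff_0_char_elem_mult)
  finally show "coeff (b j * char_elem p * b k) 0 = coeff (cscale (p j) (char_elem p) * b k) 0" .
qed

text \<open>Applying \<open>f\<close> to \<open>mult_char_elem\<close> gives the two factors
  \<open>f (b j)\<close> and \<open>p j\<close> for the same number; this is the orthogonality of
  distinct characters.\<close>

lemma character_char_elem:
  assumes p: "multiplicative p" and f: "linear_character cscale f"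
    and j: "j < r" "p j \<noteq> f (b j)"
  shows "f (char_elem p) = 0"
proof -
  interpret f: Vector_Spaces.linear cscale "(*)" f
    using f by (simp add: linear_character_def)
  have "f (b j) * f (char_elem p) = p j * f (char_elem p)"
    using arg_cong[OF mult_char_elem[OF p j(1)], of f] f by (simp add: f.scale linear_character_def)
  then show ?thesis using j(2) by auto
qed

lemma struct_const_of_real:
  assumes "i < r" "j < r" "k < r"
  obtains l :: real where "coeff (b i * b j) k = of_real l" "0 \<le> l"
  using struct_const_real[OF assms] struct_const_nonneg[OF assms]
  by (auto simp: struct_const_eq_coeff elim: Reals_cases)

lemma degree_product:
  assumes "i < r" "j < r"
  shows "(\<Sum>k<r. Re (coeff (b i * b j) k) * deg k) = deg i * deg j"
proof -
  have "complex_of_real (deg i * deg j) = (\<Sum>k<r. coeff (b i * b j) k * of_real (deg k))"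
    using linear_functional_eq_sum[OF linear_degree, of "b i * b j"] assms
    by (simp add: degree_mult degree_basis)
  then have "deg i * deg j = Re (\<Sum>k<r. coeff (b i * b j) k * of_real (deg k))"
    by (metis Re_complex_of_real)
  then show ?thesis by simp
qed

lemma cmod_struct_const:
  assumes "i < r" "j < r" "k < r"
  shows "cmod (coeff (b i * b j) k) = Re (coeff (b i * b j) k)"
  using struct_const_of_real[OF assms] by fastforce

text \<open>A Perron-Frobenius argument: at an index \<open>m\<close> maximizing
  \<open>cmod (p m) / deg m\<close>, expanding \<open>b i * b m\<close> with nonnegative structure
  constants bounds \<open>cmod (p i * p m)\<close> by the maximum times
  \<open>deg i * deg m\<close>.\<close>

lemma cmod_multiplicative_le:
  assumes p: "multiplicative p" and p0: "p 0 \<noteq> 0" and i: "i < r"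
  shows "cmod (p i) \<le> deg i"
proof -
  let ?f = "\<lambda>k. cmod (p k) / deg k"
  define M where "M = Max (?f ` {..<r})"
  have ne: "finite (?f ` {..<r})" "?f ` {..<r} \<noteq> {}" using i by auto
  have "M \<in> ?f ` {..<r}" unfolding M_def by (rule Max_in[OF ne])
  then obtain m where m: "m < r" "M = ?f m" by auto
  have bound: "cmod (p k) \<le> M * deg k" if "k < r" for k
  proof -
    have "?f k \<le> M" unfolding M_def using that by (intro Max_ge) auto
    then show ?thesis using deg_pos[OF that] by (simp add: field_simps)
  qed
  have r: "0 < r" using i by simp
  \<comment> \<open>The maximum is positive because \<open>p 0\<close> is nonzero; hence
    \<open>M * deg m\<close>, which is \<open>cmod (p m)\<close>, can be cancelled at the
    end.\<close>
  have M: "0 < M"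
  proof -
    have "0 < cmod (p 0)" using p0 by simp
    also note bound[OF r]
    finally show ?thesis using deg_pos[OF r] by (simp add: zero_less_mult_iff)
  qed
  have "cmod (p i) * (M * deg m) = cmod (p i * p m)"
    using m deg_pos[OF m(1)] by (simp add: norm_mult)
  also have "\<dots> = cmod (\<Sum>k<r. coeff (b i * b m) k * p k)"
    using p i m by (simp add: multiplicative_def)
  also have "\<dots> \<le> (\<Sum>k<r. Re (coeff (b i * b m) k) * (M * deg k))"
  proof (rule sum_norm_le)
    fix k assume "k \<in> {..<r}"
    then have k: "k < r" by simp
    show "cmod (coeff (b i * b m) k * p k) \<le> Re (coeff (b i * b m) k) * (M * deg k)"
      unfolding norm_mult cmod_struct_const[OF i m(1) k]
      using bound[OF k] struct_const_nonneg[OF i m(1) k]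
      by (intro mult_left_mono) (auto simp: struct_const_eq_coeff)
  qed
  also have "\<dots> = M * (deg i * deg m)"
    by (simp add: sum_distrib_left mult_ac flip: degree_product[OF i m(1)])
  finally have "(M * deg m) * cmod (p i) \<le> (M * deg m) * deg i" by (simp add: mult_ac)
  then show ?thesis using M deg_pos[OF m(1)] by simp
qed

lemma multiplicative_deg: "multiplicative (\<lambda>i. of_real (deg i))"
proof -
  have "multiplicative (\<lambda>i. \<delta> (b i))"
    using degree_map by (intro multiplicative_linear_character) (simp add: positive_degree_map_def)
  moreover have "(\<Sum>k<r. c k * \<delta> (b k)) = (\<Sum>k<r. c k * of_real (deg k))" for c
    by (intro sum.cong) (simp_all add: degree_basis)
  ultimately show ?thesis by (simp add: multiplicative_def degree_basis)
qed

text \<open>Conjugation passes through the defining sums because the structure constants are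
  real.\<close>

lemma multiplicative_cnj:
  assumes "multiplicative p" shows "multiplicative (\<lambda>i. cnj (p i))"
proof -
  have "(\<Sum>k<r. coeff (b i * b j) k * cnj (p k)) = cnj (p i) * cnj (p j)"
    if ij: "i < r" "j < r" for i j
  proof -
    have "(\<Sum>k<r. coeff (b i * b j) k * cnj (p k)) = (\<Sum>k<r. cnj (coeff (b i * b j) k * p k))"
    proof (rule sum.cong[OF refl])
      fix k assume "k \<in> {..<r}"
      then obtain l where "coeff (b i * b j) k = of_real l"
        using struct_const_of_real[OF ij, of k] by auto
      then show "coeff (b i * b j) k * cnj (p k) = cnj (coeff (b i * b j) k * p k)" by simp
    qed
    also have "\<dots> = cnj (p i * p j)"
      using assms ij unfolding cnj_sum[symmetric] by (simp only: multiplicative_def)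
    finally show ?thesis by simp
  qed
  then show ?thesis by (simp add: multiplicative_def)
qed

end

section \<open>The second linear character\<close>

lemma (in complex_star_algebra) star_one: "star 1 = 1"
  by (metis star_mult star_star mult_1 mult_1_right)

lemma matrix_cayley_hamilton_2:
  fixes M :: "complex^2^2"
  shows "(M ** M) $ i $ j = trace M * M $ i $ j - det M * mat 1 $ i $ j"
  using exhaust_2[of i] exhaust_2[of j]
  by (auto simp: matrix_matrix_mult_def sum_2 trace_def det_2 mat_def algebra_simps)

context noncommutative_rank6_table_algebra
begin

lemma lessThan_6: "{..<6::nat} = {0, 1, 2, 3, 4, 5}"
  by auto

lemma less_6_cases: "i < (6::nat) \<longleftrightarrow> i = 0 \<or> i = 1 \<or> i = 2 \<or> i = 3 \<or> i = 4 \<or> i = 5"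
  by auto

lemma star_5: "star (b 5) = b 4"
  by (metis star_45 star_star)

lemma star_index_values:
  "si 0 = 0" "si 1 = 1" "si (Suc 0) = Suc 0" "si 2 = 2" "si 3 = 3" "si 4 = 5" "si 5 = 4"
  using star_123 by (auto intro!: star_index_eqI simp: basis_0 star_one star_45 star_5)

lemma deg_0: "deg 0 = 1"
  by (simp add: deg_def basis_0 degree_one)

lemma deg_5: "deg 5 = deg 4"
  using deg_star_index[of 4] by (simp add: star_index_values)

definition n :: real where "n = (\<Sum>i<6. deg i)"

lemma n_eq: "n = 1 + deg 1 + deg 2 + deg 3 + 2 * deg 4"
  by (simp add: n_def lessThan_6 deg_0 deg_5)

lemma n_pos: "n > 0"
  unfolding n_eq using deg_pos[of 1] deg_pos[of 2] deg_pos[of 3] deg_pos[of 4] by simp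

lemma trace_eq: "of_real n * coeff x 0 = \<delta> x + of_real m\<^sub>\<phi> * \<phi> x + of_real m\<^sub>X * X x"
  using multiplicities[of x]
  by (simp add: standard_feasible_trace_def coeff_def n_def degree_basis)

section \<open>The two-dimensional irreducible representation\<close>

definition \<rho> :: "'a \<Rightarrow> complex^2^2"
  where "\<rho> = (SOME \<rho>. irreducible_representation cscale \<rho> \<and> X = (\<lambda>x. trace (\<rho> x)))"

lemma rho: "irreducible_representation cscale \<rho>" and X_eq: "X x = trace (\<rho> x)"
proof -
  have "\<exists>\<rho> :: 'a \<Rightarrow> complex^2^2. irreducible_representation cscale \<rho> \<and> X = (\<lambda>x. trace (\<rho> x))"
    using X by (simp add: irreducible_character_2_def)
  from someI_ex[OF this] have "irreducible_representation cscale \<rho> \<and> X = (\<lambda>x. trace (\<rho> x))"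
    by (simp add: \<rho>_def)
  then show "irreducible_representation cscale \<rho>" "X x = trace (\<rho> x)"
    by (blast, blast dest: fun_cong)
qed

lemma rho_add: "\<rho> (x + y) = \<rho> x + \<rho> y"
  and rho_mult: "\<rho> (x * y) = \<rho> x ** \<rho> y"
  and rho_one: "\<rho> 1 = mat 1"
  using rho by (simp_all add: irreducible_representation_def)

lemma rho_scale: "\<rho> (cscale c x) $ i $ j = c * \<rho> x $ i $ j"
  using rho by (simp add: irreducible_representation_def)

text \<open>A nonzero vector \<open>\<rho> e *v v\<close> would be a common eigenvector of all
  \<open>\<rho> x\<close>, and its line a proper invariant subspace of the plane.\<close>

lemma rho_eq_0I:
  assumes "\<And>x. \<exists>c. x * e = cscale c e"
  shows "\<rho> e = 0"
proof -
  have ev: "\<exists>c. \<rho> x *v (\<rho> e *v v) = c *s (\<rho> e *v v)" for x v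
  proof -
    obtain c where "x * e = cscale c e" using assms by blast
    then have "\<rho> x ** \<rho> e = \<rho> (cscale c e)" by (metis rho_mult)
    then have "\<rho> x *v (\<rho> e *v v) = \<rho> (cscale c e) *v v"
      by (simp add: matrix_vector_mul_assoc)
    also have "\<dots> = c *s (\<rho> e *v v)"
      by (simp add: vec_eq_iff matrix_vector_mult_def rho_scale sum_distrib_left mult.assoc)
    finally show ?thesis by blast
  qed
  have "\<rho> e *v v = 0" for v
  proof (rule ccontr)
    let ?w = "\<rho> e *v v"
    assume w: "?w \<noteq> 0"
    let ?W = "range (\<lambda>a. a *s ?w)"
    have "vec.subspace ?W"
      using vec.subspace_span[of "{?w}"] by (simp only: vec.span_singleton)
    moreover have "\<rho> x *v u \<in> ?W" if u: "u \<in> ?W" for x u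
    proof -
      from u obtain a where a: "u = a *s ?w" by auto
      obtain c where "\<rho> x *v ?w = c *s ?w" using ev by blast
      then have "\<rho> x *v u = (a * c) *s ?w" unfolding a
        by (metis vector_scalar_commute vector_smult_assoc)
      then show ?thesis by blast
    qed
    ultimately have "?W = {0} \<or> ?W = UNIV"
      using rho unfolding irreducible_representation_def by blast
    moreover have "?w \<in> ?W" by (rule image_eqI[of _ _ 1]) simp_all
    ultimately have W: "?W = UNIV" using w by blast
    \<comment> \<open>If the line were the whole plane, both standard basis vectors would be
      multiples of \<open>?w\<close>, which their coordinates rule out.\<close>
    then obtain a c where "axis 1 1 = a *s ?w" "axis 2 1 = c *s ?w"
      by (metis (no_types, lifting) UNIV_I imageE)
    then have "(axis 1 1 :: complex^2) $ 1 = a * ?w $ 1" "(axis 1 1 :: complex^2) $ 2 = a * ?w $ 2"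
      "(axis 2 1 :: complex^2) $ 1 = c * ?w $ 1" "(axis 2 1 :: complex^2) $ 2 = c * ?w $ 2"
      by simp_all
    then show False by (auto simp: axis_def)
  qed
  then show ?thesis by (simp add: matrix_eq)
qed

text \<open>By \<open>mult_char_elem\<close> this element is an eigenvector of every left
  multiplication.\<close>

lemma rho_char_elem:
  assumes p: "multiplicative p" shows "\<rho> (char_elem p) = 0"
proof (rule rho_eq_0I)
  fix x
  have "x * char_elem p = (\<Sum>i<6. cscale (coeff x i) (b i * char_elem p))"
    by (subst coeff_expansion[of x, symmetric]) (simp only: sum_distrib_right scale_mult_left)
  also have "\<dots> = cscale (\<Sum>i<6. coeff x i * p i) (char_elem p)"
    by (simp add: mult_char_elem[OF p] scale_sum_left)
  finally show "\<exists>c. x * char_elem p = cscale c (char_elem p)" by blast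
qed

lemma X_char_elem: "multiplicative p \<Longrightarrow> X (char_elem p) = 0"
  by (simp add: X_eq rho_char_elem trace_def)

section \<open>The linear characters and the trace formula\<close>

lemma degree_character: "linear_character cscale \<delta>"
  using degree_map by (simp add: positive_degree_map_def)

lemma linear_phi: "Vector_Spaces.linear cscale (*) \<phi>"
  using phi by (simp add: linear_character_def)

lemma phi_mult: "\<phi> (x * y) = \<phi> x * \<phi> y" and phi_one: "\<phi> 1 = 1"
  using phi by (simp_all add: linear_character_def)

lemma multiplicative_phi: "multiplicative (\<lambda>i. \<phi> (b i))"
  by (rule multiplicative_linear_character[OF phi(1)])

text \<open>If \<open>p\<close> differed from both, then \<delta>, \<phi> and \<open>X\<close> would
  all vanish on \<open>char_elem p\<close>, so by the trace formula its coefficient at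
  \<open>b 0\<close> would be 0; but that coefficient is \<open>p 0\<close>.\<close>

lemma multiplicative_eq_linear_character:
  assumes p: "multiplicative p" and p0: "p 0 \<noteq> 0"
  shows "(\<forall>i<6. p i = \<delta> (b i)) \<or> (\<forall>i<6. p i = \<phi> (b i))"
proof (rule ccontr)
  assume "\<not> ?thesis"
  then obtain i j where "i < 6" "p i \<noteq> \<delta> (b i)" "j < 6" "p j \<noteq> \<phi> (b j)" by blast
  then have "\<delta> (char_elem p) = 0" "\<phi> (char_elem p) = 0"
    using character_char_elem[OF p degree_character] character_char_elem[OF p phi(1)] by blast+
  then have "of_real n * coeff (char_elem p) 0 = 0"
    using trace_eq[of "char_elem p"] X_char_elem[OF p] by simp
  then show False
    using n_pos p0 coeff_0_char_elem_mult[of 0 p] by (simp add: basis_0)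
qed

lemma phi_neq_degree: "\<exists>i<6. \<phi> (b i) \<noteq> \<delta> (b i)"
proof (rule ccontr)
  assume "\<not> ?thesis"
  then have "(\<Sum>i<6. coeff x i * \<phi> (b i)) = (\<Sum>i<6. coeff x i * \<delta> (b i))" for x
    by simp
  then have "\<phi> x = \<delta> x" for x
    by (simp only: flip: linear_functional_eq_sum[OF linear_degree] linear_functional_eq_sum[OF linear_phi])
  then show False using phi(2) by blast
qed

text \<open>The conjugate of \<phi> must again be \<delta> or \<phi>; it cannot be \<delta>, which
  is real on the basis and different from \<phi>.\<close>

lemma phi_real: assumes "i < 6" shows "\<phi> (b i) \<in> \<real>"
proof -
  have "(\<forall>i<6. cnj (\<phi> (b i)) = \<delta> (b i)) \<or> (\<forall>i<6. cnj (\<phi> (b i)) = \<phi> (b i))"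
    using multiplicative_eq_linear_character[OF multiplicative_cnj[OF multiplicative_phi]]
    by (simp add: basis_0 phi_one)
  moreover have "\<not> (\<forall>i<6. cnj (\<phi> (b i)) = \<delta> (b i))"
  proof
    assume "\<forall>i<6. cnj (\<phi> (b i)) = \<delta> (b i)"
    then have "\<forall>i<6. \<phi> (b i) = \<delta> (b i)"
      by (metis degree_basis complex_cnj_cnj complex_cnj_complex_of_real)
    then show False using phi_neq_degree by blast
  qed
  ultimately show ?thesis using assms by (simp add: Reals_cnj_iff)
qed

lemma degree_char_elem_phi: "\<delta> (char_elem (\<lambda>i. \<phi> (b i))) = 0"
  using phi_neq_degree character_char_elem[OF multiplicative_phi degree_character] by blast

text \<open>This is the trace formula at the element representing \<phi>, whose coefficient at
  \<open>b 0\<close> is 1 and on which \<delta> and \<open>X\<close> vanish.\<close>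

lemma phi_orthogonality:
  "of_real m\<^sub>\<phi> * (\<Sum>i<6. \<phi> (b (si i)) / of_real (deg i) * \<phi> (b i)) = of_real n"
proof -
  let ?e = "char_elem (\<lambda>i. \<phi> (b i))"
  have "coeff ?e 0 = 1"
    using coeff_0_char_elem_mult[of 0 "\<lambda>i. \<phi> (b i)"] by (simp add: basis_0 phi_one)
  then have "of_real n = of_real m\<^sub>\<phi> * \<phi> ?e"
    using trace_eq[of ?e] X_char_elem[OF multiplicative_phi] degree_char_elem_phi by simp
  also have "\<phi> ?e = (\<Sum>i<6. \<phi> (b (si i)) / of_real (deg i) * \<phi> (b i))"
    using linear_functional_eq_sum[OF linear_phi, of ?e] by (simp add: coeff_char_elem)
  finally show ?thesis by simp
qed

text \<open>All three maps also kill every \<open>x * b k\<close>, so the trace formula makes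
  \<open>x\<close> orthogonal to the basis in the trace form.\<close>

lemma faithful:
  assumes "\<delta> x = 0" "\<phi> x = 0" "\<rho> x = 0"
  shows "x = 0"
proof (rule trace_form_nondegenerate)
  fix k :: nat
  have "of_real n * coeff (x * b k) 0 = 0"
    using assms trace_eq[of "x * b k"] by (simp add: degree_mult phi_mult X_eq rho_mult trace_def)
  then show "coeff (x * b k) 0 = coeff (0 * b k) 0" using n_pos by (simp add: coeff_zero)
qed

lemma m_X_eq: "2 * m\<^sub>X = n - 1 - m\<^sub>\<phi>"
proof -
  have "X 1 = 2" by (simp add: X_eq rho_one trace_I)
  then have "complex_of_real n = 1 + of_real m\<^sub>\<phi> + of_real m\<^sub>X * 2"
    using trace_eq[of 1] coeff_basis[of 0 0] by (simp add: basis_0 degree_one phi_one)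
  then have "complex_of_real n = of_real (1 + m\<^sub>\<phi> + m\<^sub>X * 2)" by simp
  then have "n = 1 + m\<^sub>\<phi> + m\<^sub>X * 2" unfolding of_real_eq_iff .
  then show ?thesis by simp
qed

end

section \<open>The bipartite grading and integrality\<close>

text \<open>Applied with \<open>m\<close> the common degree of \<open>b 2\<close> and
  \<open>b 3\<close>. The equations force \<open>m\<close> to divide \<open>d\<^sub>4\<close>, and
  positivity of \<open>d\<^sub>1\<close> bounds \<open>d\<^sub>4\<close> by
  \<open>m\<close>.\<close>

lemma integral_deg_arith:
  fixes c c' d\<^sub>1 d\<^sub>4 m :: int
  assumes "0 < m" "0 < d\<^sub>1" "0 < d\<^sub>4" "1 + 2 * m = d\<^sub>1 + 2 * d\<^sub>4"
    and "d\<^sub>1 * d\<^sub>1 = d\<^sub>1 + c * (2 * m)" "d\<^sub>4 * d\<^sub>4 = c' * (2 * m)"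
  shows "d\<^sub>1 = 1" "d\<^sub>4 = m" "m = 2 * c'"
proof -
  have d1: "d\<^sub>1 = 1 + 2 * m - 2 * d\<^sub>4" using assms(4) by simp
  \<comment> \<open>Expand \<open>(1 + 2 * m - 2 * d\<^sub>4) * (2 * m - 2 * d\<^sub>4) = c * (2 *
    m)\<close> and replace \<open>d\<^sub>4 * d\<^sub>4\<close> by \<open>c' * (2 * m)\<close>: only
    \<open>- 2 * d\<^sub>4\<close> remains without a factor \<open>m\<close>.\<close>
  have "2 * d\<^sub>4 = m * (2 * (2 * m + 1 - 4 * d\<^sub>4 - c) + 8 * c')"
    using assms(5,6) unfolding d1 by algebra
  then have "d\<^sub>4 = m * (2 * m + 1 - 4 * d\<^sub>4 - c + 4 * c')" by algebra
  then obtain k where k: "d\<^sub>4 = m * k" by blast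
  have "0 < k" using k assms(1,3) by (simp add: zero_less_mult_iff)
  moreover have "k \<le> 1"
  proof -
    have "m * k \<le> m * 1" using d1 assms(2) k by simp
    then show ?thesis using assms(1) by simp
  qed
  ultimately have "k = 1" by simp
  then show d4: "d\<^sub>4 = m" using k by simp
  then show "d\<^sub>1 = 1" using d1 by simp
  show "m = 2 * c'" using assms(1,6) d4 by simp
qed

context real_bipartite_rank6_table_algebra
begin

definition eps :: "nat \<Rightarrow> real" where "eps i = (if i \<in> {0, 2, 3} then 1 else - 1)"

text \<open>With multiplicity 1, \<open>phi_orthogonality\<close> equates the sum of
  \<open>\<phi> (b (si j)) * \<phi> (b j) / deg j\<close> with the sum of the degrees. Each term is
  at most \<open>deg j\<close>, so equality holds termwise and \<phi> has absolute value
  \<open>deg i\<close> at \<open>b i\<close>; the kernel decides the sign.\<close>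

lemma phi_basis: assumes i: "i < 6" shows "\<phi> (b i) = of_real (eps i * deg i)"
proof -
  define f where "f j = Re (\<phi> (b j))" for j
  have phi_f: "\<phi> (b j) = of_real (f j)" if "j < 6" for j
    using phi_real[OF that] by (simp add: f_def)
  have abs_le: "\<bar>f j\<bar> \<le> deg j" if "j < 6" for j
    using cmod_multiplicative_le[OF multiplicative_phi _ that] phi_f[OF that]
    by (simp add: basis_0 phi_one)
  have sq_le: "f (si j) / deg j * f j \<le> deg j" if j: "j < 6" for j
  proof -
    have "f (si j) * f j \<le> \<bar>f (si j)\<bar> * \<bar>f j\<bar>" by (metis abs_ge_self abs_mult)
    also have "\<dots> \<le> deg j * deg j"
      using abs_le[OF j] abs_le[OF star_index(1)[OF j]] deg_star_index[OF j]
      by (intro mult_mono) auto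
    finally show ?thesis using deg_pos[OF j] by (simp add: field_simps)
  qed
  have "complex_of_real (\<Sum>j<6. f (si j) / deg j * f j) =
      (\<Sum>j<6. \<phi> (b (si j)) / of_real (deg j) * \<phi> (b j))"
    unfolding of_real_sum
    by (intro sum.cong refl) (simp only: lessThan_iff phi_f star_index(1) of_real_mult of_real_divide)
  also have "\<dots> = of_real n"
    using phi_orthogonality by (simp add: multiplicity_phi)
  finally have "(\<Sum>j<6. f (si j) / deg j * f j) = (\<Sum>j<6. deg j)"
    unfolding of_real_eq_iff n_def .
  then have "(\<Sum>j<6. deg j - f (si j) / deg j * f j) = 0" by (simp add: sum_subtractf)
  then have "deg i - f (si i) / deg i * f i = 0"
    using sq_le i by (subst (asm) sum_nonneg_eq_0_iff) auto
  then have eq: "f (si i) * f i = deg i * deg i"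
    using deg_pos[OF i] by (simp add: field_simps)
  have "deg i * deg i = \<bar>f (si i)\<bar> * \<bar>f i\<bar>" by (simp add: eq flip: abs_mult)
  also have "\<dots> \<le> deg i * \<bar>f i\<bar>"
    using abs_le[OF star_index(1)[OF i]] deg_star_index[OF i] by (intro mult_right_mono) auto
  finally have "deg i \<le> \<bar>f i\<bar>" using deg_pos[OF i] by simp
  then have f: "f i = deg i \<or> f i = - deg i" using abs_le[OF i] by linarith
  have "b i \<in> character_kernel 6 b \<delta> \<phi> \<longleftrightarrow> f i = deg i"
    using i by (simp add: character_kernel_def phi_f degree_basis)
  then have "f i = deg i \<longleftrightarrow> i \<in> {0, 2, 3}"
    using i by (simp add: kernel_phi basis_eq_iff)
  then show ?thesis using f phi_f[OF i] by (auto simp: eps_def)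
qed

text \<open>Comparing \<delta> and \<phi> on \<open>b i * b j\<close> gives a vanishing sum with
  weights \<open>1 - eps i * eps j * eps l\<close>, each 0 or 2; nonnegative structure constants
  make every term vanish.\<close>

lemma product_grading:
  assumes ijk: "i < 6" "j < 6" "k < 6" and eps: "eps i * eps j \<noteq> eps k"
  shows "coeff (b i * b j) k = 0"
proof -
  let ?l = "\<lambda>k. Re (coeff (b i * b j) k)"
  have real: "coeff (b i * b j) l = of_real (?l l)" if "l < 6" for l
    using struct_const_of_real[OF ijk(1,2) that] by fastforce
  have pos: "0 \<le> ?l l" if "l < 6" for l
    using struct_const_nonneg[OF ijk(1,2) that] by (simp add: struct_const_eq_coeff)
  have e: "eps l \<in> {1, - 1}" for l by (simp add: eps_def)
  have "complex_of_real (\<Sum>l<6. ?l l * (eps l * deg l)) = (\<Sum>l<6. coeff (b i * b j) l * \<phi> (b l))"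
    unfolding of_real_sum
    by (intro sum.cong refl) (metis lessThan_iff of_real_mult phi_basis real)
  also have "\<dots> = of_real (eps i * eps j * (deg i * deg j))"
    using multiplicative_phi ijk by (simp add: multiplicative_def phi_basis mult_ac)
  finally have "(\<Sum>l<6. ?l l * (eps l * deg l)) = eps i * eps j * (deg i * deg j)"
    unfolding of_real_eq_iff .
  also have "\<dots> = eps i * eps j * (\<Sum>l<6. ?l l * deg l)"
    by (simp only: degree_product[OF ijk(1,2)])
  finally have sum: "(\<Sum>l<6. ?l l * (eps l * deg l)) = eps i * eps j * (\<Sum>l<6. ?l l * deg l)" .
  have "(\<Sum>l<6. ?l l * deg l * (1 - eps i * eps j * eps l)) =
      (\<Sum>l<6. ?l l * deg l) - eps i * eps j * (\<Sum>l<6. ?l l * (eps l * deg l))"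
    by (simp add: sum_distrib_left algebra_simps flip: sum_subtractf)
  also have "\<dots> = 0"
    unfolding sum using e[of i] e[of j] by auto
  finally have "(\<Sum>l<6. ?l l * deg l * (1 - eps i * eps j * eps l)) = 0" .
  moreover have "0 \<le> ?l l * deg l * (1 - eps i * eps j * eps l)" if "l < 6" for l
    using pos[OF that] deg_pos[OF that] e[of i] e[of j] e[of l] by auto
  ultimately have "?l k * deg k * (1 - eps i * eps j * eps k) = 0"
    using ijk(3) by (subst (asm) sum_nonneg_eq_0_iff) auto
  moreover have "1 - eps i * eps j * eps k \<noteq> 0"
    using eps e[of i] e[of j] e[of k] by auto
  ultimately have "?l k = 0" using deg_pos[OF ijk(3)] by simp
  then show ?thesis by (metis of_real_0 real ijk(3))
qed

section \<open>The kernel sum and the elements annihilated by the representation\<close>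

definition kernel_sum :: 'a where "kernel_sum = b 0 + b 2 + b 3"

text \<open>Since \<delta> vanishes on the element representing \<phi>, the degrees summed with the
  signs \<open>eps\<close> cancel.\<close>

lemma kernel_degree: "1 + deg 2 + deg 3 = deg 1 + 2 * deg 4"
proof -
  have "(\<Sum>i<6. eps (si i) * deg i * deg i / deg i) = 0"
  proof -
    have "complex_of_real (\<Sum>i<6. eps (si i) * deg i * deg i / deg i) =
        (\<Sum>i<6. coeff (char_elem (\<lambda>i. \<phi> (b i))) i * \<delta> (b i))"
      unfolding of_real_sum
      by (intro sum.cong refl)
         (simp only: lessThan_iff coeff_char_elem phi_basis star_index(1) deg_star_index degree_basis, simp)
    also have "\<dots> = \<delta> (char_elem (\<lambda>i. \<phi> (b i)))"
      by (rule linear_functional_eq_sum[OF linear_degree, symmetric])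
    finally show ?thesis unfolding degree_char_elem_phi of_real_eq_0_iff .
  qed
  moreover have "(\<Sum>i<6. eps (si i) * deg i * deg i / deg i) =
      (\<Sum>i<6. eps (si i) * deg i)"
    by (intro sum.cong) (auto dest: deg_pos)
  ultimately show ?thesis
    by (simp add: lessThan_6 star_index_values eps_def deg_0 deg_5)
qed

lemma n_eq_kernel: "n = 2 * (1 + deg 2 + deg 3)"
  using n_eq kernel_degree by simp

lemma m_X_eq_deg: "m\<^sub>X = deg 2 + deg 3"
  using m_X_eq by (simp add: multiplicity_phi n_eq_kernel)

text \<open>The first summand is the sum of the whole basis, the second the same sum with signs
  \<open>eps\<close>, so the odd elements cancel. This carries \<open>rho_char_elem\<close> over to
  the kernel sum.\<close>

lemma kernel_sum_eq:
  "cscale 2 kernel_sum = char_elem (\<lambda>i. of_real (deg i)) + char_elem (\<lambda>i. \<phi> (b i))"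
proof (rule coeff_eqI)
  fix i :: nat assume i: "i < 6"
  have "coeff (char_elem (\<lambda>i. of_real (deg i)) + char_elem (\<lambda>i. \<phi> (b i))) i = of_real (1 + eps (si i))"
    using i deg_pos[OF i]
    by (simp add: coeff_add coeff_char_elem phi_basis star_index(1) deg_star_index del: star_index(2))
  also have "\<dots> = coeff (cscale 2 kernel_sum) i"
    using i unfolding less_6_cases
    by (elim disjE) (simp_all add: kernel_sum_def coeff_scale coeff_add coeff_basis star_index_values eps_def)
  finally show "coeff (cscale 2 kernel_sum) i =
      coeff (char_elem (\<lambda>i. of_real (deg i)) + char_elem (\<lambda>i. \<phi> (b i))) i" by simp
qed

lemma rho_kernel_sum: "\<rho> kernel_sum = 0"
proof -
  have "\<rho> (cscale 2 kernel_sum) = 0"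
    by (simp add: kernel_sum_eq rho_add rho_char_elem multiplicative_deg multiplicative_phi)
  then have "2 * \<rho> kernel_sum $ i $ j = 0" for i j by (simp flip: rho_scale)
  then show ?thesis by (simp add: vec_eq_iff)
qed

text \<open>Subtracting the multiple of \<open>kernel_sum\<close> with the same degree as
  \<open>y\<close> leaves an element to which \<open>faithful\<close> applies.\<close>

lemma rho_kernel:
  assumes \<rho>: "\<rho> y = 0" and \<phi>: "\<phi> y = \<delta> y"
  shows "\<exists>c. y = cscale c kernel_sum"
proof -
  interpret d: Vector_Spaces.linear cscale "(*)" \<delta> by (rule linear_degree)
  interpret p: Vector_Spaces.linear cscale "(*)" \<phi> by (rule linear_phi)
  define k where "k = \<delta> kernel_sum"
  have k: "\<phi> kernel_sum = k" "k = of_real (1 + deg 2 + deg 3)"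
    by (simp_all add: k_def kernel_sum_def d.add p.add phi_basis degree_basis eps_def deg_0)
  have "k \<noteq> 0"
    using deg_pos[of 2] deg_pos[of 3] unfolding k of_real_eq_0_iff by simp
  define z where "z = y - cscale (\<delta> y / k) kernel_sum"
  have "\<delta> z = 0" "\<phi> z = 0"
    using \<open>k \<noteq> 0\<close> \<phi> by (simp_all add: z_def d.diff d.scale p.diff p.scale k flip: k_def)
  moreover have "\<rho> z = 0"
  proof -
    have "\<rho> z + \<rho> (cscale (\<delta> y / k) kernel_sum) = \<rho> y"
      by (simp add: z_def flip: rho_add)
    moreover have "\<rho> (cscale (\<delta> y / k) kernel_sum) = 0"
      by (simp add: vec_eq_iff rho_scale rho_kernel_sum)
    ultimately show ?thesis using \<rho> by simp
  qed
  ultimately have "z = 0" by (rule faithful)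
  then show ?thesis unfolding z_def by auto
qed

text \<open>The trace formula at a basis element whose coefficient at \<open>b 0\<close> is 0. For
  odd \<open>i\<close> it gives \<open>X (b i) = 0\<close>.\<close>

lemma X_basis:
  assumes "i < 6" "i \<noteq> 0"
  shows "of_real m\<^sub>X * X (b i) = - of_real (deg i + eps i * deg i)"
  using trace_eq[of "b i"] assms
  by (simp add: coeff_basis multiplicity_phi degree_basis phi_basis algebra_simps add_eq_0_iff)

lemma square_basis:
  assumes i: "i < 6" "i \<noteq> 0"
  shows "\<exists>c d. b i * b i = cscale (X (b i)) (b i) + cscale c kernel_sum + cscale d 1"
proof -
  interpret d: Vector_Spaces.linear cscale "(*)" \<delta> by (rule linear_degree)
  interpret p: Vector_Spaces.linear cscale "(*)" \<phi> by (rule linear_phi)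
  define y where "y = b i * b i + cscale (- X (b i)) (b i) + cscale (det (\<rho> (b i))) 1"
  have "\<rho> y = 0"
    unfolding vec_eq_iff y_def
    by (simp only: vector_add_component rho_add rho_scale rho_mult rho_one
        matrix_cayley_hamilton_2 X_eq) simp
  moreover have "\<phi> y = \<delta> y"
  proof -
    \<comment> \<open>For even \<open>i\<close> the values of \<phi> and \<delta> agree; for odd
      \<open>i\<close> the factor \<open>X (b i)\<close> is 0.\<close>
    have "X (b i) * \<phi> (b i) = X (b i) * \<delta> (b i)"
    proof (cases "eps i = 1")
      case True
      then show ?thesis using i by (simp add: phi_basis degree_basis)
    next
      case False
      then have "eps i = - 1" by (auto simp: eps_def split: if_splits)
      then show ?thesis using X_basis[OF i] multiplicities_pos by simp
    qed
    moreover have "\<phi> (b i) * \<phi> (b i) = \<delta> (b i) * \<delta> (b i)"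
      using i by (simp add: phi_basis degree_basis eps_def)
    ultimately show ?thesis
      by (auto simp: y_def d.add d.diff d.scale p.add p.diff p.scale phi_mult degree_mult phi_one degree_one)
  qed
  ultimately obtain c where "y = cscale c kernel_sum" using rho_kernel by blast
  then have "b i * b i = cscale (X (b i)) (b i) + cscale c kernel_sum + cscale (- det (\<rho> (b i))) 1"
    by (simp add: y_def algebra_simps eq_neg_iff_add_eq_0)
  then show ?thesis by blast
qed

text \<open>In \<open>square_basis\<close> the kernel sum contributes equally at \<open>b 2\<close>
  and \<open>b 3\<close>, so the difference isolates the linear term. For an integral basis
  \<open>X (b 2)\<close> is therefore an integer.\<close>

lemma X_basis_2: "X (b 2) = coeff (b 2 * b 2) 2 - coeff (b 2 * b 2) 3"
proof -
  obtain c d where eq: "b 2 * b 2 = cscale (X (b 2)) (b 2) + cscale c kernel_sum + cscale d (b 0)"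
    using square_basis[of 2] by (auto simp: basis_0)
  show ?thesis
    unfolding eq by (simp add: coeff_add coeff_scale coeff_basis kernel_sum_def)
qed

text \<open>For these \<open>i\<close> the linear term lies off \<open>b 2\<close> and
  \<open>b 3\<close>, and only the kernel sum contributes there.\<close>

lemma coeff_square_odd:
  assumes "i = 1 \<or> i = 4"
  shows "coeff (b i * b i) 2 = coeff (b i * b i) 3"
proof -
  obtain c d where eq: "b i * b i = cscale (X (b i)) (b i) + cscale c kernel_sum + cscale d (b 0)"
    using square_basis[of i] assms by (auto simp: basis_0)
  show ?thesis
    unfolding eq using assms by (auto simp add: coeff_add coeff_scale coeff_basis kernel_sum_def)
qed

lemma degree_square_1: "deg 1 * deg 1 = deg 1 + Re (coeff (b 1 * b 1) 2) * (deg 2 + deg 3)"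
proof -
  have "coeff (b 1 * b 1) k = 0" if "k \<in> {1, 4, 5}" for k
    using that by (auto intro!: product_grading simp: eps_def)
  then show ?thesis
    using degree_product[of 1 1] coeff_square_odd[of 1] coeff_0_mult_basis[of 1 1]
    by (simp add: lessThan_6 star_index_values deg_0 algebra_simps)
qed

text \<open>Unlike for \<open>b 1\<close>, the coefficient at \<open>b 0\<close> vanishes, because
  \<open>b 4\<close> is not fixed by \<open>star\<close>.\<close>

lemma degree_square_4: "deg 4 * deg 4 = Re (coeff (b 4 * b 4) 2) * (deg 2 + deg 3)"
proof -
  have "coeff (b 4 * b 4) k = 0" if "k \<in> {1, 4, 5}" for k
    using that by (auto intro!: product_grading simp: eps_def)
  then show ?thesis
    using degree_product[of 4 4] coeff_square_odd[of 4] coeff_0_mult_basis[of 4 4]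
    by (simp add: lessThan_6 star_index_values algebra_simps)
qed

lemma X_basis_2_deg: "X (b 2) * of_real (deg 2 + deg 3) = - 2 * of_real (deg 2)"
  using X_basis[of 2] by (simp add: m_X_eq_deg eps_def mult.commute)

lemma integral_imp_degrees:
  assumes int: "integral_basis cscale 6 b"
  shows "deg 1 = 1 \<and> deg 2 = deg 3 \<and> deg 3 = deg 4 \<and> (\<exists>k::int. deg 2 = 2 * of_int k)"
proof -
  have coeff_int: "\<exists>z. coeff (b i * b j) k = of_int z" if "i < 6" "j < 6" "k < 6" for i j k
    using int that unfolding integral_basis_def struct_const_eq_coeff by (meson Ints_cases)
  have deg_int: "\<exists>z. deg i = of_int z" if i: "i < 6" for i
  proof -
    obtain z where "coeff (b i * b (si i)) 0 = of_int z"
      using coeff_int[OF i star_index(1)[OF i], of 0] by auto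
    then have "complex_of_real (deg i) = of_real (of_int z)"
      using coeff_0_mult_basis[OF i star_index(1)[OF i]] by simp
    then show ?thesis unfolding of_real_eq_iff by blast
  qed
  obtain d1 d2 d4 where d: "deg 1 = of_int d1" "deg 2 = of_int d2" "deg 4 = of_int d4"
    using deg_int[of 1] deg_int[of 2] deg_int[of 4] by auto
  have pos: "0 < deg 2" "0 < deg 3" "0 < deg 1" "0 < deg 4" by (simp_all add: deg_pos)
  obtain s s' where "coeff (b 2 * b 2) 2 = of_int s" "coeff (b 2 * b 2) 3 = of_int s'"
    using coeff_int[of 2 2 2] coeff_int[of 2 2 3] by auto
  then obtain t where t: "X (b 2) = of_int t"
    unfolding X_basis_2 by (metis of_int_diff)
  then have "complex_of_real (of_int t * (deg 2 + deg 3)) = of_real (- 2 * deg 2)"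
    using X_basis_2_deg by simp
  then have teq: "of_int t * (deg 2 + deg 3) = - 2 * deg 2" unfolding of_real_eq_iff .
  \<comment> \<open>The integer \<open>t\<close> is \<open>- 2 * deg 2 / (deg 2 + deg 3)\<close>,
    strictly between -2 and 0; hence it is -1, which says \<open>deg 2 = deg 3\<close>.\<close>
  have "t < 0"
  proof (rule ccontr)
    assume "\<not> t < 0"
    then have "0 \<le> of_int t * (deg 2 + deg 3)" using pos by simp
    then show False using teq pos by simp
  qed
  moreover have "- 2 < t"
  proof (rule ccontr)
    assume "\<not> - 2 < t"
    then have "real_of_int t \<le> - 2" by linarith
    then have "of_int t * (deg 2 + deg 3) \<le> - 2 * (deg 2 + deg 3)"
      using pos by (intro mult_right_mono) auto
    then show False using teq pos by simp
  qed
  ultimately have "t = - 1" by simp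
  then have d23: "deg 2 = deg 3" using teq by simp
  obtain c c' where c: "Re (coeff (b 1 * b 1) 2) = of_int c" "Re (coeff (b 4 * b 4) 2) = of_int c'"
    using coeff_int[of 1 1 2] coeff_int[of 4 4 2] by auto
  have "d1 * d1 = d1 + c * (2 * d2)"
    using degree_square_1 unfolding c d d23[symmetric] by (simp flip: of_int_mult of_int_add)
  moreover have "d4 * d4 = c' * (2 * d2)"
    using degree_square_4 unfolding c d d23[symmetric] by (simp flip: of_int_mult of_int_add)
  moreover have "1 + 2 * d2 = d1 + 2 * d4"
    using kernel_degree unfolding d d23[symmetric] by linarith
  moreover have "0 < d2" "0 < d1" "0 < d4" using pos d by simp_all
  ultimately have "d1 = 1" "d4 = d2" "d2 = 2 * c'" using integral_deg_arith[of d2 d1 d4 c c'] by blast+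
  then show ?thesis using d d23 by auto
qed

end

section \<open>Extensions by an involution swapping two basis elements\<close>

lemma based_on_simps:
  "smul (based_on cscale S) = cscale" "mul (based_on cscale S) = (*)"
  "unit (based_on cscale S) = 1" "basis (based_on cscale S) = S"
  by (simp_all add: based_on_def)

lemma lookup_sd_smul: "Poly_Mapping.lookup (sd_smul c x) k = c * Poly_Mapping.lookup x k"
  by (auto simp: sd_smul_def map.rep_eq when_def)

lemma vector_space_sd_smul: "vector_space sd_smul"
  by unfold_locales (auto intro!: poly_mapping_eqI simp: lookup_sd_smul lookup_add algebra_simps)

lemma sd_smul_single: "sd_smul c (Poly_Mapping.single p a) = Poly_Mapping.single p (c * a)"
  by (rule poly_mapping_eqI) (simp add: lookup_sd_smul lookup_single when_def)

lemma sd_smul_sd_smul: "sd_smul c (sd_smul a x) = sd_smul (c * a) x"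
  by (rule poly_mapping_eqI) (simp add: lookup_sd_smul)

text \<open>Isolates the relations behind the semidirect product: \<open>w\<close> will be
  \<open>b 1\<close>, and \<open>u\<close>, \<open>v\<close> will be \<open>b 2\<close>,
  \<open>b 3\<close> in a suitable order.\<close>

locale swap_extension = complex_star_algebra cscale star
  for cscale :: "complex \<Rightarrow> 'a::ring_1 \<Rightarrow> 'a" and star +
  fixes u v w :: 'a
  assumes distinct_basis: "distinct [1, u, v, w, w * u, w * v]"
    and independent_basis: "independent {1, u, v, w, w * u, w * v}"
    and span_basis: "span {1, u, v, w, w * u, w * v} = UNIV"
    and ww: "w * w = 1" and wu: "w * u = v * w" and wv: "w * v = u * w"
    and uu: "u * u \<in> span {1, u, v}" and uv: "u * v \<in> span {1, u, v}"
    and vu: "v * u \<in> span {1, u, v}" and vv: "v * v \<in> span {1, u, v}"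
begin

abbreviation N where "N \<equiv> {1, u, v}"
abbreviation B where "B \<equiv> {1, u, v, w, w * u, w * v}"
abbreviation \<sigma> where "\<sigma> \<equiv> Transposition.transpose u v"
abbreviation A\<^sub>N where "A\<^sub>N \<equiv> based_on cscale N"
abbreviation G where "G \<equiv> exact_aut A\<^sub>N"

lemma independent_N: "independent N"
  by (rule independent_mono[OF independent_basis]) auto

lemma sigma_simps: "\<sigma> 1 = 1" "\<sigma> u = v" "\<sigma> v = u"
  using distinct_basis by (auto simp: Transposition.transpose_def)

lemma sigma_neq_id: "\<sigma> \<noteq> id"
proof
  assume "\<sigma> = id"
  then have "\<sigma> u = u" by simp
  then show False using distinct_basis by (simp add: sigma_simps)
qed

lemma scale_sum_mult_left: "y * (\<Sum>i\<in>I. cscale (c i) (f i)) = (\<Sum>i\<in>I. cscale (c i) (y * f i))"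
  by (simp add: sum_distrib_left scale_mult_right)

lemma scale_sum_mult_right: "(\<Sum>i\<in>I. cscale (c i) (f i)) * y = (\<Sum>i\<in>I. cscale (c i) (f i * y))"
  by (simp add: sum_distrib_right scale_mult_left)

lemma scale_sum_mult: "(\<Sum>i\<in>I. cscale (c i) (f i)) * (\<Sum>j\<in>J. cscale (a j) (h j)) =
    (\<Sum>i\<in>I. cscale (c i) (\<Sum>j\<in>J. cscale (a j) (f i * h j)))"
  by (subst scale_sum_mult_right) (simp only: scale_sum_mult_left)

lemma span_N_expansion:
  assumes "x \<in> span N" shows "x = (\<Sum>d\<in>N. cscale (representation N x d) d)"
  by (rule sum_representation_eq[OF independent_N assms, symmetric]) auto

lemma mult_N: "d \<in> N \<Longrightarrow> e \<in> N \<Longrightarrow> d * e \<in> span N"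
  using uu uv vu vv by (auto intro: span_base)

lemma mult_span_N:
  assumes "x \<in> span N" "y \<in> span N" shows "x * y \<in> span N"
proof -
  have "x * y = (\<Sum>d\<in>N. cscale (representation N x d) d) * (\<Sum>d\<in>N. cscale (representation N y d) d)"
    using span_N_expansion[OF assms(1)] span_N_expansion[OF assms(2)] by (simp only:)
  also have "\<dots> = (\<Sum>d\<in>N. cscale (representation N x d) (\<Sum>e\<in>N. cscale (representation N y e) (d * e)))"
    by (rule scale_sum_mult)
  also have "\<dots> \<in> span N"
    by (intro span_sum span_scale mult_N)
  finally show ?thesis .
qed

lemma mult_ww: "x * w * w = x"
  by (simp add: mult.assoc ww)

lemma conj_N: "d \<in> N \<Longrightarrow> w * d * w = \<sigma> d"
  by (auto simp: sigma_simps ww wu wv mult_ww)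

text \<open>Conjugation by \<open>w\<close> is linear and induces \<sigma> on \<open>N\<close>; in
  this form the extension is visibly multiplicative.\<close>

lemma lin_ext_sigma: "x \<in> span N \<Longrightarrow> lin_ext A\<^sub>N A\<^sub>N \<sigma> x = w * x * w"
proof -
  assume x: "x \<in> span N"
  have "w * x * w = w * (\<Sum>d\<in>N. cscale (representation N x d) d) * w"
    using span_N_expansion[OF x] by (simp only:)
  also have "\<dots> = (\<Sum>d\<in>N. cscale (representation N x d) (w * d * w))"
    by (simp only: scale_sum_mult_right scale_sum_mult_left)
  also have "\<dots> = (\<Sum>d\<in>N. cscale (representation N x d) (\<sigma> d))"
    by (intro sum.cong refl) (simp only: conj_N)
  finally show ?thesis by (simp only: lin_ext_def coord_def based_on_simps)
qed

lemma lin_ext_id: "x \<in> span N \<Longrightarrow> lin_ext A\<^sub>N A\<^sub>N id x = x"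
  using span_N_expansion[of x]
  by (simp only: lin_ext_def coord_def based_on_simps id_apply)

lemma conj_span_N:
  assumes x: "x \<in> span N" shows "w * x * w \<in> span N"
proof -
  have "\<sigma> d \<in> N" if "d \<in> N" for d using that by (auto simp: sigma_simps)
  then show ?thesis
    unfolding lin_ext_sigma[OF x, symmetric] lin_ext_def based_on_simps
    by (intro span_sum span_scale span_base)
qed

lemma conj_conj: "w * (w * x * w) * w = x"
  by (metis mult.assoc mult_1_left mult_1_right ww)

lemma id_in_G: "id \<in> G"
proof -
  have bij: "bij_betw (lin_ext A\<^sub>N A\<^sub>N id) (span N) (span N)"
    using lin_ext_id by (intro bij_betw_byWitness[where f' = id]) auto
  show ?thesis
    using bij
    by (simp add: exact_aut_def exact_iso_def permutes_id algebra_iso_def carrier_of_def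
        based_on_simps lin_ext_id span_add span_scale mult_span_N span_base)
qed

text \<open>As conjugation by an involution, the extension is multiplicative, fixes 1 and is its own
  inverse.\<close>

lemma sigma_in_G: "\<sigma> \<in> G"
proof -
  have perm: "\<sigma> permutes N" by (rule permutes_swap_id) auto
  have bij: "bij_betw (lin_ext A\<^sub>N A\<^sub>N \<sigma>) (span N) (span N)"
    using lin_ext_sigma conj_span_N conj_conj
    by (intro bij_betw_byWitness[where f' = "\<lambda>x. w * x * w"]) auto
  have mult: "w * (x * y) * w = (w * x * w) * (w * y * w)" for x y
    by (metis mult.assoc mult_1_left ww)
  show ?thesis
    using bij perm
    by (simp add: exact_aut_def exact_iso_def algebra_iso_def carrier_of_def
        based_on_simps lin_ext_sigma span_add span_scale mult_span_N span_base permutes_imp_bij ww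
        distrib_left distrib_right scale_mult_left scale_mult_right mult)
qed

text \<open>An automorphism fixes the unit, so it can only fix or swap \<open>u\<close> and
  \<open>v\<close>.\<close>

lemma G_eq: "G = {id, \<sigma>}"
proof (intro equalityI subsetI)
  fix g assume g: "g \<in> G"
  have perm: "g permutes N" and one: "lin_ext A\<^sub>N A\<^sub>N g 1 = 1"
    using g by (simp_all add: exact_aut_def exact_iso_def algebra_iso_def based_on_simps)
  have "lin_ext A\<^sub>N A\<^sub>N g 1 = (\<Sum>d\<in>N. cscale (if d = 1 then 1 else 0) (g d))"
    by (simp only: lin_ext_def coord_def based_on_simps
        representation_basis[OF independent_N, of 1] insertI1)
  also have "\<dots> = g 1" using distinct_basis by simp
  finally have g1: "g 1 = 1" using one by simp
  have out: "g x = x" if "x \<notin> N" for x using perm that by (simp add: permutes_def)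
  have "g u \<in> N" "g v \<in> N" "inj g"
    using permutes_in_image[OF perm] permutes_inj[OF perm] by auto
  moreover have "g u \<noteq> g 1" "g v \<noteq> g 1" "g u \<noteq> g v"
    using distinct_basis \<open>inj g\<close> by (auto simp: inj_eq)
  ultimately have "g u = u \<and> g v = v \<or> g u = v \<and> g v = u" using g1 by auto
  then show "g \<in> {id, \<sigma>}"
  proof
    assume "g u = u \<and> g v = v"
    then have "g x = x" for x using g1 out by (cases "x \<in> N") auto
    then show ?thesis by auto
  next
    assume "g u = v \<and> g v = u"
    then have "g x = \<sigma> x" for x
      using g1 out by (cases "x \<in> N") (auto simp: sigma_simps Transposition.transpose_def)
    then show ?thesis by auto
  qed
next
  fix g assume "g \<in> {id, \<sigma>}"
  then show "g \<in> G" using id_in_G sigma_in_G by auto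
qed

section \<open>The isomorphism onto the semidirect product\<close>

definition W :: "('a \<Rightarrow> 'a) \<Rightarrow> 'a" where "W g = (if g = id then 1 else w)"

text \<open>\<open>W\<close> lifts each automorphism to an element inducing it by conjugation, so
  pairs in \<open>G \<times> N\<close> can be read as products in the algebra.\<close>

definition \<kappa> :: "('a \<Rightarrow> 'a) \<times> 'a \<Rightarrow> 'a" where "\<kappa> p = W (fst p) * snd p"

lemma bij_kappa: "bij_betw \<kappa> (G \<times> N) B"
proof -
  \<comment> \<open>Listing the six pairs lets \<open>distinct_map\<close> turn distinctness of the
    basis into injectivity of \<open>\<kappa>\<close>.\<close>
  define xs where "xs = [(id, 1), (id, u), (id, v), (\<sigma>, 1), (\<sigma>, u), (\<sigma>, v)]"
  have G_N: "G \<times> N = set xs" unfolding G_eq xs_def by auto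
  have map: "map \<kappa> xs = [1, u, v, w, w * u, w * v]"
    unfolding xs_def by (simp add: \<kappa>_def W_def sigma_neq_id)
  have "inj_on \<kappa> (set xs)" using distinct_basis by (simp only: distinct_map flip: map)
  moreover have "\<kappa> ` set xs = B" by (simp only: map list.set flip: set_map)
  ultimately show ?thesis by (simp only: G_N bij_betw_def)
qed

lemma kappa_in_B: "p \<in> G \<times> N \<Longrightarrow> \<kappa> p \<in> B"
  using bij_kappa by (rule bij_betwE[THEN bspec])

text \<open>Moving \<open>W h\<close> to the left past \<open>d\<close> turns \<open>d\<close> into
  \<open>h d\<close>, which is the action in the multiplication rule of the semidirect
  product.\<close>

lemma kappa_mult:
  assumes "g \<in> G" "d \<in> N" "h \<in> G" "e \<in> N"
  shows "\<kappa> (g, d) * \<kappa> (h, e) = W (h \<circ> g) * (h d * e)"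
proof -
  have "d * W h = W h * h d"
    using assms(2,3) wu wv by (auto simp: G_eq W_def sigma_simps)
  moreover have "W g * W h = W (h \<circ> g)"
    using assms(1,3) ww sigma_neq_id by (auto simp: G_eq W_def)
  ultimately show ?thesis
    unfolding \<kappa>_def fst_conv snd_conv by (metis mult.assoc)
qed

definition f :: "'a \<Rightarrow> (('a \<Rightarrow> 'a) \<times> 'a \<Rightarrow>\<^sub>0 complex)"
  where "f x = Poly_Mapping.single (inv_into (G \<times> N) \<kappa> x) 1"

abbreviation A where "A \<equiv> based_on cscale B"

definition F :: "'a \<Rightarrow> (('a \<Rightarrow> 'a) \<times> 'a \<Rightarrow>\<^sub>0 complex)"
  where "F = lin_ext A (semidirect G A\<^sub>N) f"

lemma F_eq: "F x = (\<Sum>p\<in>G \<times> N. Poly_Mapping.single p (representation B x (\<kappa> p)))"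
proof -
  have "F x = (\<Sum>d\<in>B. sd_smul (representation B x d) (f d))"
    by (simp only: F_def lin_ext_def coord_def based_on_simps semidirect_def based_algebra.simps)
  also have "\<dots> = (\<Sum>p\<in>G \<times> N. sd_smul (representation B x (\<kappa> p)) (f (\<kappa> p)))"
    by (rule sum.reindex_bij_betw[OF bij_kappa, symmetric])
  also have "\<dots> = (\<Sum>p\<in>G \<times> N. Poly_Mapping.single p (representation B x (\<kappa> p)))"
    by (intro sum.cong refl)
       (simp only: f_def bij_betw_inv_into_left[OF bij_kappa] sd_smul_single mult_1_right)
  finally show ?thesis .
qed

lemma finite_G_N: "finite (G \<times> N)"
  by (simp add: G_eq)

lemma lookup_F: "p \<in> G \<times> N \<Longrightarrow> Poly_Mapping.lookup (F x) p = representation B x (\<kappa> p)"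
  using finite_G_N by (simp add: F_eq lookup_sum lookup_single when_def)

lemma linear_F: "Vector_Spaces.linear cscale sd_smul F"
proof -
  interpret V: vector_space sd_smul by (rule vector_space_sd_smul)
  show ?thesis
  proof unfold_locales
    show "F (x + y) = F x + F y" for x y
      by (simp only: F_eq representation_add[OF independent_basis] span_basis UNIV_I
          single_add sum.distrib)
    show "F (cscale c x) = sd_smul c (F x)" for c x
      by (simp only: F_eq representation_scale[OF independent_basis] span_basis UNIV_I
          V.scale_sum_right sd_smul_single)
  qed
qed

lemma F_kappa:
  assumes "p \<in> G \<times> N" shows "F (\<kappa> p) = Poly_Mapping.single p 1"
proof -
  have "\<kappa> q = \<kappa> p \<longleftrightarrow> q = p" if "q \<in> G \<times> N" for q
    using bij_kappa assms that by (auto simp: bij_betw_def dest: inj_onD)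
  then have "F (\<kappa> p) = (\<Sum>q\<in>G \<times> N. if q = p then Poly_Mapping.single p 1 else 0)"
    unfolding F_eq representation_basis[OF independent_basis kappa_in_B[OF assms]]
    by (intro sum.cong) auto
  then show ?thesis using assms finite_G_N by simp
qed

text \<open>Both sides are linear in \<open>z\<close> and agree on \<open>N\<close>. This evaluates
  \<open>F\<close> on the right-hand side of \<open>kappa_mult\<close>, where \<open>h d * e\<close>
  is in general a combination of several basis elements.\<close>

lemma F_W_mult:
  assumes k: "k \<in> G" and z: "z \<in> span N"
  shows "F (W k * z) = sd_embed A\<^sub>N k z"
proof -
  interpret F: Vector_Spaces.linear cscale sd_smul F by (rule linear_F)
  have "F (W k * z) = F (W k * (\<Sum>d\<in>N. cscale (representation N z d) d))"
    using span_N_expansion[OF z] by (simp only:)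
  also have "\<dots> = (\<Sum>d\<in>N. sd_smul (representation N z d) (F (\<kappa> (k, d))))"
    by (simp only: scale_sum_mult_left F.sum F.scale \<kappa>_def fst_conv snd_conv)
  also have "\<dots> = (\<Sum>d\<in>N. Poly_Mapping.single (k, d) (representation N z d))"
    using k by (intro sum.cong refl) (simp only: F_kappa mem_Times_iff fst_conv snd_conv sd_smul_single, simp)
  finally show ?thesis by (simp only: sd_embed_def coord_def based_on_simps)
qed

lemma B_expansion: "x = (\<Sum>p\<in>G \<times> N. cscale (representation B x (\<kappa> p)) (\<kappa> p))"
proof -
  have "x = (\<Sum>d\<in>B. cscale (representation B x d) d)"
    by (rule sum_representation_eq[OF independent_basis, symmetric]) (auto simp: span_basis)
  also have "\<dots> = (\<Sum>p\<in>G \<times> N. cscale (representation B x (\<kappa> p)) (\<kappa> p))"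
    by (rule sum.reindex_bij_betw[OF bij_kappa, symmetric])
  finally show ?thesis .
qed

text \<open>Both factors are expanded in the basis \<open>\<kappa> p\<close>;
  \<open>kappa_mult\<close> then produces the double sum defining \<open>sd_mul\<close>.\<close>

lemma F_mult: "F (x * y) = sd_mul G A\<^sub>N (F x) (F y)"
proof -
  interpret F: Vector_Spaces.linear cscale sd_smul F by (rule linear_F)
  let ?r = "representation B"
  have "x * y = (\<Sum>p\<in>G \<times> N. cscale (?r x (\<kappa> p)) (\<kappa> p)) * (\<Sum>q\<in>G \<times> N. cscale (?r y (\<kappa> q)) (\<kappa> q))"
    using B_expansion[of x] B_expansion[of y] by (simp only:)
  also have "\<dots> = (\<Sum>p\<in>G \<times> N. cscale (?r x (\<kappa> p)) (\<Sum>q\<in>G \<times> N. cscale (?r y (\<kappa> q)) (\<kappa> p * \<kappa> q)))"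
    by (rule scale_sum_mult)
  finally have "F (x * y) = (\<Sum>p\<in>G \<times> N. \<Sum>q\<in>G \<times> N. sd_smul (?r x (\<kappa> p) * ?r y (\<kappa> q)) (F (\<kappa> p * \<kappa> q)))"
    by (simp only: F.sum F.scale F.vs2.scale_sum_right sd_smul_sd_smul)
  also have "\<dots> = (\<Sum>(g, d)\<in>G \<times> N. \<Sum>(h, e)\<in>G \<times> N.
      sd_smul (Poly_Mapping.lookup (F x) (g, d) * Poly_Mapping.lookup (F y) (h, e))
        (sd_embed A\<^sub>N (h \<circ> g) (h d * e)))"
  proof (intro sum.cong refl, unfold split_beta, intro sum.cong refl)
    fix p q assume pq: "p \<in> G \<times> N" "q \<in> G \<times> N"
    then have gd: "fst p \<in> G" "snd p \<in> N" "fst q \<in> G" "snd q \<in> N" by auto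
    have "fst q \<circ> fst p \<in> G" using gd(1,3) by (auto simp: G_eq)
    moreover have "fst q (snd p) \<in> N" using gd(2,3) by (auto simp: G_eq sigma_simps)
    ultimately have "F (\<kappa> p * \<kappa> q) = sd_embed A\<^sub>N (fst q \<circ> fst p) (fst q (snd p) * snd q)"
      using kappa_mult[OF gd] gd(4) by (simp add: F_W_mult mult_N)
    then show "sd_smul (?r x (\<kappa> p) * ?r y (\<kappa> q)) (F (\<kappa> p * \<kappa> q)) =
        sd_smul (Poly_Mapping.lookup (F x) (fst p, snd p) * Poly_Mapping.lookup (F y) (fst q, snd q))
          (sd_embed A\<^sub>N (fst q \<circ> fst p) (fst q (snd p) * snd q))"
      by (simp only: prod.collapse lookup_F[OF pq(1)] lookup_F[OF pq(2)])
  qed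
  also have "\<dots> = sd_mul G A\<^sub>N (F x) (F y)"
    by (simp only: sd_mul_def based_on_simps)
  finally show ?thesis .
qed

lemma inj_F: "inj F"
proof (rule injI)
  fix x y assume "F x = F y"
  then have "representation B x (\<kappa> p) = representation B y (\<kappa> p)" if "p \<in> G \<times> N" for p
    using lookup_F[OF that] by metis
  then have "(\<Sum>p\<in>G \<times> N. cscale (representation B x (\<kappa> p)) (\<kappa> p)) =
      (\<Sum>p\<in>G \<times> N. cscale (representation B y (\<kappa> p)) (\<kappa> p))"
    by (intro sum.cong) auto
  then show "x = y" by (simp only: B_expansion[symmetric])
qed

lemma range_F: "range F = module.span sd_smul ((\<lambda>p. Poly_Mapping.single p 1) ` (G \<times> N))"
proof -
  interpret F: Vector_Spaces.linear cscale sd_smul F by (rule linear_F)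
  have "range F = F ` span B" by (simp only: span_basis)
  also have "\<dots> = F.vs2.span (F ` B)" by (rule F.span_image[symmetric])
  also have "F ` B = F ` \<kappa> ` (G \<times> N)" by (simp only: bij_betw_imp_surj_on[OF bij_kappa])
  also have "\<dots> = (\<lambda>p. Poly_Mapping.single p 1) ` (G \<times> N)"
    unfolding image_image by (intro image_cong refl F_kappa)
  finally show ?thesis .
qed

lemma bij_f: "bij_betw f B ((\<lambda>p. Poly_Mapping.single p 1) ` (G \<times> N))"
proof -
  have "bij_betw (\<lambda>p. Poly_Mapping.single p (1 :: complex)) (G \<times> N)
      ((\<lambda>p. Poly_Mapping.single p 1) ` (G \<times> N))"
    by (intro bij_betw_imageI inj_onI refl) (metis lookup_single_eq lookup_single_not_eq zero_neq_one)
  then show ?thesis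
    using bij_betw_trans[OF bij_betw_inv_into[OF bij_kappa]] by (simp add: f_def[abs_def] comp_def)
qed

theorem exactly_isomorphic_semidirect: "exactly_isomorphic A (semidirect G A\<^sub>N)"
proof -
  interpret F: Vector_Spaces.linear cscale sd_smul F by (rule linear_F)
  have one: "F 1 = Poly_Mapping.single (id, 1) 1"
    using F_kappa[of "(id, 1)"] id_in_G by (simp add: \<kappa>_def W_def)
  have bij: "bij_betw F UNIV (module.span sd_smul ((\<lambda>p. Poly_Mapping.single p 1) ` (G \<times> N)))"
    using inj_F range_F by (simp only: bij_betw_def)
  have sd: "smul (semidirect G A\<^sub>N) = sd_smul" "mul (semidirect G A\<^sub>N) = sd_mul G A\<^sub>N"
    "unit (semidirect G A\<^sub>N) = Poly_Mapping.single (id, 1) 1"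
    "basis (semidirect G A\<^sub>N) = (\<lambda>p. Poly_Mapping.single p 1) ` (G \<times> N)"
    by (simp_all only: semidirect_def based_on_simps based_algebra.simps)
  have "algebra_iso A (semidirect G A\<^sub>N) F"
    unfolding algebra_iso_def carrier_of_def based_on_simps sd span_basis
    using bij F.add F.scale F_mult one by blast
  then have "exact_iso A (semidirect G A\<^sub>N) f"
    unfolding exact_iso_def F_def[symmetric] based_on_simps sd using bij_f by blast
  then show ?thesis unfolding exactly_isomorphic_def by blast
qed

end

section \<open>The structure of the algebra with prescribed degrees\<close>

locale uniform_degrees = real_bipartite_rank6_table_algebra +
  assumes deg_1: "deg 1 = 1" and deg_23: "deg 2 = deg 3" and deg_34: "deg 3 = deg 4"
begin

definition m :: real where "m = deg 2"

lemma m_pos: "0 < m" and deg_m: "deg 2 = m" "deg 3 = m" "deg 4 = m" "deg 5 = m"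
  using deg_pos[of 2] deg_23 deg_34 deg_5 by (simp_all add: m_def)

lemma real_coeff: "i < 6 \<Longrightarrow> j < 6 \<Longrightarrow> k < 6 \<Longrightarrow>
    coeff (b i * b j) k = of_real (Re (coeff (b i * b j) k))"
  by (metis struct_const_of_real Re_complex_of_real)

text \<open>With \<open>deg 1 = 1\<close>, \<open>degree_square_1\<close> leaves no room for a
  coefficient at \<open>b 2\<close> or \<open>b 3\<close>, and the grading removes the odd
  ones.\<close>

lemma square_1: "b 1 * b 1 = 1"
proof -
  have odd: "coeff (b 1 * b 1) k = 0" if "k \<in> {1, 4, 5}" for k
    using that by (auto intro!: product_grading simp: eps_def)
  have "Re (coeff (b 1 * b 1) 2) = 0"
    using degree_square_1 m_pos by (simp add: deg_1 deg_m del: One_nat_def)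
  moreover have "coeff (b 1 * b 1) 2 = of_real (Re (coeff (b 1 * b 1) 2))"
    by (rule real_coeff) simp_all
  ultimately have c2: "coeff (b 1 * b 1) 2 = 0" by (simp only: of_real_0)
  then have c3: "coeff (b 1 * b 1) 3 = 0" using coeff_square_odd[of 1] by simp
  have c0: "coeff (b 1 * b 1) 0 = 1"
    using coeff_0_mult_basis[of 1 1] by (simp add: star_index_values deg_1 del: One_nat_def)
  have "b 1 * b 1 = b 0"
  proof (rule coeff_eqI)
    fix k :: nat assume "k < 6"
    then show "coeff (b 1 * b 1) k = coeff (b 0) k"
      unfolding less_6_cases using odd c0 c2 c3 by (auto simp: coeff_basis)
  qed
  then show ?thesis by (simp add: basis_0)
qed

lemma cancel_1: "b 1 * (b 1 * x) = x" "x * b 1 * b 1 = x"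
  by (simp only: square_1 mult_1 flip: mult.assoc) (simp only: square_1 mult_1_right mult.assoc)

text \<open>The product is odd, and its coefficient at \<open>b 1\<close> is the trace of
  \<open>b 1 * b 1 * b j = b j\<close>, which is 0. With \<open>q\<close> and \<open>s\<close> its
  coefficients at \<open>b 4\<close> and \<open>b 5\<close>, degrees give \<open>q + s = 1\<close>,
  and the trace of the product with its star gives \<open>q * q + s * s = 1\<close>.\<close>

lemma mult_1_kernel:
  assumes j: "j \<in> {2, 3}"
  shows "b 1 * b j = b 4 \<or> b 1 * b j = b 5"
proof -
  have j6: "j < 6" "j \<noteq> 0" and si_j: "si j = j" and deg_j: "deg j = m"
    using j by (auto simp: star_index_values deg_m)
  let ?x = "b 1 * b j"
  have even: "coeff ?x k = 0" if "k \<in> {0, 2, 3}" for k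
    using j that by (auto intro!: product_grading simp: eps_def)
  have "coeff ?x 1 = coeff (?x * b 1) 0"
    using coeff_0_mult_star[of 1 ?x] by (simp add: star_index_values deg_1 del: One_nat_def)
  also have "\<dots> = coeff (b 1 * (b 1 * b j)) 0" by (rule trace_form_comm)
  also have "\<dots> = 0" using j6 by (simp only: cancel_1) (simp add: coeff_basis)
  finally have c1: "coeff ?x 1 = 0" .
  define q s where "q = Re (coeff ?x 4)" and "s = Re (coeff ?x 5)"
  have qs: "coeff ?x 4 = of_real q" "coeff ?x 5 = of_real s"
    unfolding q_def s_def using j6 by (auto intro: real_coeff)
  have x: "?x = cscale (of_real q) (b 4) + cscale (of_real s) (b 5)"
  proof (rule coeff_eqI)
    fix k :: nat assume "k < 6"
    then show "coeff ?x k = coeff (cscale (of_real q) (b 4) + cscale (of_real s) (b 5)) k"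
      unfolding less_6_cases using even c1 qs
      by (elim disjE) (simp_all add: coeff_add coeff_scale coeff_basis)
  qed
  have "q * m + s * m = m"
    using degree_product[of 1 j] j6 even c1
    by (simp add: lessThan_6 deg_j deg_m deg_1 q_def s_def del: One_nat_def)
  then have "(q + s - 1) * m = 0" by (simp add: algebra_simps)
  then have sum: "q + s = 1" using m_pos by simp
  have star_x: "star ?x = b j * b 1"
    using j star_123 by (auto simp: star_mult)
  \<comment> \<open>The trace of \<open>?x * star ?x\<close> is computed twice: by cyclicity and
    cancellation of \<open>b 1\<close>, and from the coordinates of \<open>?x\<close>.\<close>
  have "of_real m = coeff (b j * b j) 0"
    using coeff_0_mult_basis[of j j] j6 by (simp add: si_j deg_j)
  also have "\<dots> = coeff (?x * (b j * b 1)) 0"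
    by (metis trace_form_comm cancel_1 mult.assoc)
  also have "\<dots> = coeff (?x * star ?x) 0" by (simp only: star_x)
  also have "\<dots> = coeff ((cscale (of_real q) (b 4) + cscale (of_real s) (b 5)) *
      (cscale (of_real q) (b 5) + cscale (of_real s) (b 4))) 0"
    unfolding x by (simp add: star_add star_scale star_45 star_5)
  also have "\<dots> = of_real (q * q * m + s * s * m)"
    using coeff_0_mult_basis[of 4 4] coeff_0_mult_basis[of 4 5] coeff_0_mult_basis[of 5 4]
      coeff_0_mult_basis[of 5 5]
    by (simp add: distrib_left distrib_right scale_mult_left scale_mult_right coeff_add coeff_scale
        star_index_values deg_m)
  finally have "m = q * q * m + s * s * m" unfolding of_real_eq_iff .
  then have "(q * q + s * s - 1) * m = 0" by (simp add: algebra_simps)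
  then have "q * q + s * s = 1" using m_pos by simp
  moreover have "s = 1 - q" using sum by simp
  ultimately have "q * (q - 1) = 0" by (simp add: algebra_simps)
  then have "q = 0 \<and> s = 1 \<or> q = 1 \<and> s = 0" using sum by auto
  then show ?thesis using x by auto
qed

text \<open>Left multiplication by \<open>b 1\<close> is injective, so the two products are
  \<open>b 4\<close> and \<open>b 5\<close> in some order, which \<open>p\<close> and
  \<open>q\<close> record.\<close>

lemma kernel_labelling:
  obtains p q where "p = 2 \<and> q = 3 \<or> p = 3 \<and> q = (2::nat)" "b 1 * b p = b 4" "b 1 * b q = b 5"
proof -
  have "b 1 * b 2 \<noteq> b 1 * b 3"
  proof
    assume "b 1 * b 2 = b 1 * b 3"
    then have "b 2 = b 3" by (metis cancel_1(1))
    then show False by (simp add: basis_eq_iff)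
  qed
  then show ?thesis
    using mult_1_kernel[of 2] mult_1_kernel[of 3] that by (metis insertI1 insertI2)
qed

definition h :: complex where "h = of_real (m / 2)"

text \<open>Conjugation by \<open>b 1\<close> exchanges \<open>b p\<close> and \<open>b q\<close>.
  With cyclicity of the trace form this makes three coefficients equal to \<open>\<beta>\<close>;
  the degrees of \<open>b p * b q\<close> and \<open>b p * b p\<close> then give
  \<open>\<beta> = m / 2\<close> and \<open>\<alpha> = m / 2 - 1\<close>.\<close>

lemma kernel_products:
  assumes pq: "p = 2 \<and> q = 3 \<or> p = 3 \<and> q = (2::nat)"
    and wp: "b 1 * b p = b 4" and wq: "b 1 * b q = b 5"
  shows "b p * b 1 = b 5" "b q * b 1 = b 4"
    and "b p * b q = cscale h (b p) + cscale h (b q)"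
    and "b q * b p = cscale h (b p) + cscale h (b q)"
    and "b p * b p = cscale (2 * h) (b 0) + cscale (h - 1) (b p) + cscale h (b q)"
    and "b q * b q = cscale (2 * h) (b 0) + cscale (h - 1) (b q) + cscale h (b p)"
proof -
  have star: "star (b p) = b p" "star (b q) = b q" "star (b 1) = b 1"
    using pq star_123 by auto
  show pw: "b p * b 1 = b 5" using arg_cong[OF wp, of star] by (simp only: star_mult star star_45)
  show qw: "b q * b 1 = b 4" using arg_cong[OF wq, of star] by (simp only: star_mult star star_5)
  have q_conj: "b q = b 1 * b p * b 1" using qw wp cancel_1 by metis
  have p_conj: "b p = b 1 * b q * b 1" using pw wq cancel_1 by metis
  have pq6: "p < 6" "q < 6" "p \<noteq> 0" "q \<noteq> 0" "p \<noteq> q" "q \<noteq> p" and si: "si p = p" "si q = q"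
    and deg: "deg p = m" "deg q = m"
    and odd_neq: "p \<noteq> 1" "p \<noteq> 4" "p \<noteq> 5" "q \<noteq> 1" "q \<noteq> 4" "q \<noteq> 5"
    using pq by (auto simp: star_index_values deg_m)
  have odd: "coeff (b i * b j) k = 0" if "i \<in> {p, q}" "j \<in> {p, q}" "k \<in> {1, 4, 5}" for i j k
    using pq that by (auto intro!: product_grading simp: eps_def)
  have trace: "coeff x i = coeff (x * b i) 0 / of_real m" if "i \<in> {p, q}" for x i
    using coeff_0_mult_star[of i x] that pq6 si deg m_pos by auto
  have conj_mult: "b q * b q = b 1 * (b p * b p) * b 1"
    unfolding q_conj by (metis cancel_1 mult.assoc)
  have k_cases: "k = 0 \<or> k = p \<or> k = q \<or> k = 1 \<or> k = 4 \<or> k = 5" if "k < 6" for k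
    using pq that unfolding less_6_cases by auto
  have lessThan: "{..<6} = {0, p, q, 1, 4, 5}" using k_cases pq6 by auto
  define \<alpha> \<beta> where "\<alpha> = Re (coeff (b p * b p) p)" and "\<beta> = Re (coeff (b p * b p) q)"
  have ab: "coeff (b p * b p) p = of_real \<alpha>" "coeff (b p * b p) q = of_real \<beta>"
    unfolding \<alpha>_def \<beta>_def using pq6 by (auto intro: real_coeff)
  \<comment> \<open>The product is a real combination of \<open>b p\<close> and \<open>b q\<close>,
    hence fixed by \<open>star\<close>, which reverses the factors.\<close>
  have comm: "b q * b p = b p * b q"
  proof -
    let ?c = "coeff (b p * b q)"
    have eq: "b p * b q = cscale (?c p) (b p) + cscale (?c q) (b q)"
    proof (rule coeff_eqI)
      fix k :: nat assume "k < 6"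
      from k_cases[OF this] show "?c k = coeff (cscale (?c p) (b p) + cscale (?c q) (b q)) k"
        using pq6 odd[of p q] coeff_0_mult_basis[OF pq6(1,2)] pq
        by (auto simp: coeff_add coeff_scale coeff_basis si)
    qed
    have cnj: "cnj (?c k) = ?c k" if "k < 6" for k
      using real_coeff[OF pq6(1,2) that] by (metis complex_cnj_complex_of_real)
    have "b q * b p = star (b p * b q)" by (simp only: star_mult star)
    also have "\<dots> = star (cscale (?c p) (b p) + cscale (?c q) (b q))"
      using eq by (rule arg_cong)
    also have "\<dots> = cscale (?c p) (b p) + cscale (?c q) (b q)"
      by (simp only: star_add star_scale star cnj pq6)
    also have "\<dots> = b p * b q" by (rule eq[symmetric])
    finally show ?thesis .
  qed
  have b1: "coeff (b p * b q) p = of_real \<beta>"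
  proof -
    have "coeff (b p * b q) p = coeff (b p * b p) q"
      using trace[of p "b p * b q"] trace[of q "b p * b p"]
      by (simp add: mult.assoc comm)
    then show ?thesis using ab by simp
  qed
  \<comment> \<open>Up to the factor \<open>m\<close> this is the trace of
    \<open>b p * b q * b q\<close>, which conjugation by \<open>b 1\<close> turns into that of
    \<open>b q * b p * b p\<close>.\<close>
  have b2: "coeff (b p * b q) q = of_real \<beta>"
  proof -
    have "coeff (b p * b q) q = coeff (b p * (b q * b q)) 0 / of_real m"
      using trace[of q "b p * b q"] by (simp add: mult.assoc)
    also have "b p * (b q * b q) = b 1 * (b q * b p * b p * b 1)"
      unfolding conj_mult by (subst p_conj) (metis cancel_1 mult.assoc)
    also have "coeff (b 1 * (b q * b p * b p * b 1)) 0 = coeff (b q * b p * b p) 0"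
      by (metis cancel_1(2) trace_form_comm)
    also have "\<dots> = coeff (b p * b p * b q) 0" by (metis trace_form_comm mult.assoc)
    also have "coeff (b p * b p * b q) 0 / of_real m = coeff (b p * b p) q"
      using trace[of q "b p * b p"] by simp
    finally show ?thesis using ab by simp
  qed
  have "m * m = \<beta> * m + \<beta> * m"
    using degree_product[OF pq6(1,2)] odd[of p q] b1 b2 pq6 coeff_0_mult_basis[OF pq6(1,2)]
    unfolding lessThan using pq by (auto simp: deg si deg_m)
  then have "m * (m - 2 * \<beta>) = 0" by (simp add: algebra_simps)
  then have \<beta>: "\<beta> = m / 2" using m_pos by simp
  have "m * m = m + \<alpha> * m + \<beta> * m"
    using degree_product[OF pq6(1,1)] odd[of p p] ab pq6 coeff_0_mult_basis[OF pq6(1,1)]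
    unfolding lessThan using pq by (auto simp: deg si deg_m deg_0)
  then have "m * (m - 1 - \<alpha> - \<beta>) = 0" by (simp add: algebra_simps)
  then have \<alpha>: "\<alpha> = m / 2 - 1" using m_pos \<beta> by simp
  show pq_eq: "b p * b q = cscale h (b p) + cscale h (b q)"
  proof (rule coeff_eqI)
    fix k :: nat assume "k < 6"
    from k_cases[OF this] show "coeff (b p * b q) k = coeff (cscale h (b p) + cscale h (b q)) k"
      by (elim disjE) (simp_all add: b1 b2 \<beta> h_def pq6 odd_neq odd coeff_0_mult_basis si
          coeff_add coeff_scale coeff_basis del: One_nat_def)
  qed
  then show "b q * b p = cscale h (b p) + cscale h (b q)" by (simp add: comm)
  show pp: "b p * b p = cscale (2 * h) (b 0) + cscale (h - 1) (b p) + cscale h (b q)"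
  proof (rule coeff_eqI)
    fix k :: nat assume "k < 6"
    from k_cases[OF this] show "coeff (b p * b p) k =
        coeff (cscale (2 * h) (b 0) + cscale (h - 1) (b p) + cscale h (b q)) k"
      by (elim disjE) (simp_all add: ab \<alpha> \<beta> h_def pq6 odd_neq odd coeff_0_mult_basis si deg
          coeff_add coeff_scale coeff_basis del: One_nat_def)
  qed
  \<comment> \<open>The previous formula, conjugated by \<open>b 1\<close>.\<close>
  have "b q * b q = cscale (2 * h) (b 1 * b 1) + cscale (h - 1) (b 1 * b p * b 1) + cscale h (b 1 * b q * b 1)"
    unfolding conj_mult pp
    by (simp add: distrib_left distrib_right scale_mult_left scale_mult_right basis_0)
  then show "b q * b q = cscale (2 * h) (b 0) + cscale (h - 1) (b q) + cscale h (b p)"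
    by (simp add: basis_0 square_1 del: One_nat_def flip: q_conj p_conj)
qed

section \<open>Integrality from an even degree\<close>

definition int_coeffs :: "'a \<Rightarrow> bool" where "int_coeffs x \<longleftrightarrow> (\<forall>k<6. coeff x k \<in> \<int>)"

lemma int_coeffs_basis: "i < 6 \<Longrightarrow> int_coeffs (b i)"
  by (simp add: int_coeffs_def coeff_basis)

lemma int_coeffs_add: "int_coeffs x \<Longrightarrow> int_coeffs y \<Longrightarrow> int_coeffs (x + y)"
  by (simp add: int_coeffs_def coeff_add)

lemma int_coeffs_scale: "c \<in> \<int> \<Longrightarrow> int_coeffs x \<Longrightarrow> int_coeffs (cscale c x)"
  by (simp add: int_coeffs_def coeff_scale)

lemma int_coeffs_sum: "(\<And>i. i \<in> I \<Longrightarrow> int_coeffs (f i)) \<Longrightarrow> int_coeffs (sum f I)"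
  by (auto simp: int_coeffs_def coeff_sum)

text \<open>Multiplication by \<open>b 1\<close> on either side permutes the basis, and products
  within the kernel have coefficients built from \<open>h\<close>, here an integer.\<close>

lemma integral_if_even:
  assumes even: "m = 2 * of_int k"
  shows "integral_basis cscale 6 b"
proof -
  obtain p q where pq: "p = 2 \<and> q = 3 \<or> p = 3 \<and> q = (2::nat)"
    and wp: "b 1 * b p = b 4" and wq: "b 1 * b q = b 5" by (rule kernel_labelling)
  note prods = kernel_products[OF pq wp wq]
  have w4: "b 1 * b 4 = b p" "b 1 * b 5 = b q" using cancel_1(1) wp wq by metis+
  have w4': "b 4 * b 1 = b q" "b 5 * b 1 = b p" using cancel_1(2) prods(1,2) by metis+
  have pq6: "p < 6" "q < 6" using pq by auto
  have i_cases: "i = 0 \<or> i = p \<or> i = q \<or> i = 1 \<or> i = 4 \<or> i = 5" if "i < 6" for i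
    using pq that unfolding less_6_cases by auto
  have left: "int_coeffs (b 1 * b i)" and right: "int_coeffs (b i * b 1)" if "i < 6" for i
    using i_cases[OF that] wp wq w4 w4' prods(1,2) pq6 square_1 int_coeffs_basis[of 0]
    by (auto simp: basis_0 int_coeffs_basis)
  have left': "int_coeffs (b 1 * x)" if "int_coeffs x" for x
  proof -
    have "b 1 * x = (\<Sum>i<6. cscale (coeff x i) (b 1 * b i))"
      by (subst coeff_expansion[of x, symmetric]) (simp only: sum_distrib_left scale_mult_right)
    then show ?thesis
      using that left by (auto simp: int_coeffs_def[of x] intro: int_coeffs_sum int_coeffs_scale)
  qed
  have right': "int_coeffs (x * b 1)" if "int_coeffs x" for x
  proof -
    have "x * b 1 = (\<Sum>i<6. cscale (coeff x i) (b i * b 1))"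
      by (subst coeff_expansion[of x, symmetric]) (simp only: sum_distrib_right scale_mult_left)
    then show ?thesis
      using that right by (auto simp: int_coeffs_def[of x] intro: int_coeffs_sum int_coeffs_scale)
  qed
  have h: "h = of_int k" using even by (simp add: h_def)
  have N: "int_coeffs (b i * b j)" if "i \<in> {0, p, q}" "j \<in> {0, p, q}" for i j
    using that pq6 prods(3-6) int_coeffs_basis[of 0]
    by (auto simp: h basis_0 int_coeffs_basis intro!: int_coeffs_add int_coeffs_scale)
  \<comment> \<open>The left factor carries \<open>b 1\<close> in front and the right factor carries
    it behind, so every \<open>b 1\<close> stays outside the product of two kernel elements.\<close>
  have rep_left: "\<exists>d\<in>{0, p, q}. b i = b d \<or> b i = b 1 * b d" if "i < 6" for i
    using i_cases[OF that] wp wq by (auto simp: basis_0)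
  have rep_right: "\<exists>e\<in>{0, p, q}. b j = b e \<or> b j = b e * b 1" if "j < 6" for j
    using i_cases[OF that] prods(1,2) by (auto simp: basis_0)
  have "int_coeffs (b i * b j)" if ij: "i < 6" "j < 6" for i j
  proof -
    obtain d e where d: "d \<in> {0, p, q}" "b i = b d \<or> b i = b 1 * b d"
      and e: "e \<in> {0, p, q}" "b j = b e \<or> b j = b e * b 1"
      using rep_left[OF ij(1)] rep_right[OF ij(2)] by blast
    have N': "int_coeffs (b d * b e)" using N[OF d(1) e(1)] .
    have "b i * b j \<in> {b d * b e, b 1 * (b d * b e), b d * b e * b 1, b 1 * (b d * b e) * b 1}"
      using d(2) e(2) by (auto simp: mult.assoc)
    then show ?thesis using N' left' right' by auto
  qed
  then show ?thesis by (simp add: integral_basis_def struct_const_eq_coeff int_coeffs_def)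
qed

lemma exactly_isomorphic_semidirect:
  "exactly_isomorphic (based_on cscale (b ` {..<6}))
    (semidirect (exact_aut (based_on cscale (character_kernel 6 b \<delta> \<phi>)))
      (based_on cscale (character_kernel 6 b \<delta> \<phi>)))"
proof -
  obtain p q where pq: "p = 2 \<and> q = 3 \<or> p = 3 \<and> q = (2::nat)"
    and wp: "b 1 * b p = b 4" and wq: "b 1 * b q = b 5" by (rule kernel_labelling)
  note prods = kernel_products[OF pq wp wq]
  have B: "b ` {..<6} = {1, b p, b q, b 1, b 1 * b p, b 1 * b q}"
    using pq unfolding wp wq lessThan_6 by (auto simp: basis_0)
  have N: "character_kernel 6 b \<delta> \<phi> = {1, b p, b q}"
    using pq unfolding kernel_phi by (auto simp: basis_0)
  have dist: "distinct [1, b p, b q, b 1, b 1 * b p, b 1 * b q]"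
    using pq unfolding wp wq by (auto simp: basis_eq_iff simp flip: basis_0)
  interpret S: swap_extension cscale star "b p" "b q" "b 1"
  proof unfold_locales
    show "distinct [1, b p, b q, b 1, b 1 * b p, b 1 * b q]" by (rule dist)
    show "independent {1, b p, b q, b 1, b 1 * b p, b 1 * b q}"
      by (rule independent_basis[unfolded B])
    show "span {1, b p, b q, b 1, b 1 * b p, b 1 * b q} = UNIV"
      using span_basis by (simp only: B)
    show "b 1 * b 1 = 1" by (rule square_1)
    show "b 1 * b p = b q * b 1" "b 1 * b q = b p * b 1" using wp wq prods by simp_all
    show "b p * b p \<in> span {1, b p, b q}" "b p * b q \<in> span {1, b p, b q}"
      "b q * b p \<in> span {1, b p, b q}" "b q * b q \<in> span {1, b p, b q}"
      unfolding prods(3-6) basis_0 by (intro span_add span_scale span_base; simp)+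
  qed
  show ?thesis using S.exactly_isomorphic_semidirect by (simp only: B N)
qed

end

theorem theorem11:
  fixes cscale :: "complex \<Rightarrow> 'a::ring_1 \<Rightarrow> 'a"
    and star :: "'a \<Rightarrow> 'a" and b :: "nat \<Rightarrow> 'a"
    and \<delta> \<phi> X :: "'a \<Rightarrow> complex" and m\<^sub>\<phi> m\<^sub>X :: real
  assumes "real_bipartite_rank6_table_algebra cscale star b \<delta> \<phi> X m\<^sub>\<phi> m\<^sub>X"
  shows "(integral_basis cscale 6 b \<longleftrightarrow>
      \<delta> (b 1) = 1 \<and> \<delta> (b 2) = \<delta> (b 3) \<and> \<delta> (b 3) = \<delta> (b 4) \<and>
      (\<exists>k::int. \<delta> (b 2) = 2 * of_int k) \<and>
      (\<exists>k::int. (\<Sum>i<6. \<delta> (b i)) - 2 = 8 * of_int k))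
    \<and> (integral_basis cscale 6 b \<longrightarrow>
      exactly_isomorphic (based_on cscale (b ` {..<6}))
        (semidirect (exact_aut (based_on cscale (character_kernel 6 b \<delta> \<phi>)))
          (based_on cscale (character_kernel 6 b \<delta> \<phi>))))"
proof -
  interpret real_bipartite_rank6_table_algebra cscale star b \<delta> \<phi> X m\<^sub>\<phi> m\<^sub>X by (rule assms)
  have deg: "\<delta> (b 1) = of_real (deg 1)" "\<delta> (b 2) = of_real (deg 2)"
    "\<delta> (b 3) = of_real (deg 3)" "\<delta> (b 4) = of_real (deg 4)"
    by (simp_all only: degree_basis)
  have sum: "(\<Sum>i<6. \<delta> (b i)) = of_real n" by (simp add: n_def degree_basis)
  let ?D = "deg 1 = 1 \<and> deg 2 = deg 3 \<and> deg 3 = deg 4"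
  have uniform: "uniform_degrees cscale star b \<delta> \<phi> X m\<^sub>\<phi> m\<^sub>X" if ?D
    using that by unfold_locales auto
  have "\<delta> (b 1) = 1 \<and> \<delta> (b 2) = \<delta> (b 3) \<and> \<delta> (b 3) = \<delta> (b 4) \<and>
      (\<exists>k::int. \<delta> (b 2) = 2 * of_int k) \<and> (\<exists>k::int. (\<Sum>i<6. \<delta> (b i)) - 2 = 8 * of_int k)"
    if int: "integral_basis cscale 6 b"
  proof -
    obtain k :: int where D: ?D and k: "deg 2 = 2 * of_int k"
      using integral_imp_degrees[OF int] by blast
    \<comment> \<open>With \<open>deg 2 = deg 3\<close>, \<open>n_eq_kernel\<close> gives
      \<open>n - 2 = 4 * deg 2\<close>.\<close>
    have "n - 2 = 8 * of_int k" using D k n_eq_kernel by simp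
    then have "complex_of_real n - 2 = 8 * of_int k"
      by (metis of_real_diff of_real_mult of_real_numeral of_real_of_int_eq)
    moreover have "\<delta> (b 2) = 2 * of_int k" using k deg by simp
    ultimately show ?thesis using D deg sum by auto
  qed
  moreover have "integral_basis cscale 6 b"
    if eqs: "\<delta> (b 1) = 1" "\<delta> (b 2) = \<delta> (b 3)" "\<delta> (b 3) = \<delta> (b 4)"
      and even: "\<delta> (b 2) = 2 * of_int k" for k
  proof -
    have "deg 1 = 1" using eqs(1) unfolding deg by (simp only: of_real_eq_1_iff)
    moreover have "deg 2 = deg 3" "deg 3 = deg 4" using eqs(2,3) unfolding deg of_real_eq_iff .
    ultimately interpret U: uniform_degrees cscale star b \<delta> \<phi> X m\<^sub>\<phi> m\<^sub>X
      by (intro uniform conjI)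
    have "complex_of_real (deg 2) = of_real (2 * of_int k)" using even deg by simp
    then have "U.m = 2 * of_int k" unfolding of_real_eq_iff U.m_def .
    then show ?thesis by (rule U.integral_if_even)
  qed
  moreover have "exactly_isomorphic (based_on cscale (b ` {..<6}))
        (semidirect (exact_aut (based_on cscale (character_kernel 6 b \<delta> \<phi>)))
          (based_on cscale (character_kernel 6 b \<delta> \<phi>)))"
    if "integral_basis cscale 6 b"
    using uniform_degrees.exactly_isomorphic_semidirect[OF uniform] integral_imp_degrees[OF that]
    by blast
  ultimately show ?thesis by blast
qed

end
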